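(* Let $I\in\mathbb{S}$ be fixed, let $\varphi$ denote the Gaussian window $\varphi(t)=2^{1/4}e^{-\pi t^2}$, and consider the operator $\mathcal{A}_\varphi:L^2(\mathbb{R}^2,\mathbb{H})\to L^2(\mathbb{R},\mathbb{H})$ defined for any $F\in L^2(\mathbb{R}^2,\mathbb{H})$ by $$\mathcal{A}_\varphi(F)(y)=2^{\frac34}\int_{\mathbb{R}^2}e^{2\pi I\omega y}F(x,\omega)e^{-\pi(y-x)^2}\,dx\,d\omega,\qquad \forall y\in\mathbb{R}.$$ Then $\mathcal{A}_\varphi$ is the adjoint of $\mathcal{V}_\varphi$. Moreover, the following identity holds: $$\mathcal{V}_\varphi^*\mathcal{V}_\varphi=2\,\mathrm{Id}.$$
   Context: $\mathbb{H}$ is the algebra of real quaternions, $\mathbb{S}=\{q\in\mathbb{H}:q^2=-1\}$. $L^2(\mathbb{R},\mathbb{H})$ and $L^2(\mathbb{R}^2,\mathbb{H})$ are the right quaternionic Hilbert spaces of square integrable $\mathbb{H}$-valued functions with inner product $\langle F,G\rangle=\int\overline{G}F$. The adjoint $\mathcal{V}_\varphi^*$ is characterized by $\langle\mathcal{V}_\varphi^*F,h\rangle_{L^2(\mathbb{R},\mathbb{H})}=\langle F,\mathcal{V}_\varphi h\rangle_{L^2(\mathbb{R}^2,\mathbb{H})}$ for all $F\in L^2(\mathbb{R}^2,\mathbb{H})$, $h\in L^2(\mathbb{R},\mathbb{H})$; $\mathrm{Id}$ is the identity operator. The quaternionic Segal-Bargmann transform with parameter $\nu=2\pi$ is $\mathcal{B}^S_{\mathbb{H}}(f)(q)=\int_{\mathbb{R}}2^{3/4}e^{-\pi(q^2+t^2)+2\pi\sqrt2\,qt}f(t)\,dt$,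 $q\in\mathbb{H}$. For $I\in\mathbb{S}$ fixed, the 1D quaternion short-time Fourier transform (QSTFT) of $f\in L^2(\mathbb{R},\mathbb{H})$ with window $\varphi$ is $$\mathcal{V}_\varphi f(x,\omega)=e^{-I\pi x\omega}\,\mathcal{B}^S_{\mathbb{H}}(f)\!\left(\frac{\bar q}{\sqrt2}\right)e^{-\frac{\pi|q|^2}{2}},\qquad q=x+I\omega,\ (x,\omega)\in\mathbb{R}^2.$$
   Formalization: The integral defining A_φ(F)(y) need not converge absolutely for general F in L²; it is read as the L²-limit of the integrals over the squares [-n,n]², proved to exist and to equal the displayed integral for almost every y at which that integral converges absolutely. *)

theory Defs
  imports "HOL-Analysis.Analysis"
begin

section \<open>Real quaternions\<close>

datatype quat = Quat (qre: real) (qi: real) (qj: real) (qk: real)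

lemma quat_eq_iff: "p = q \<longleftrightarrow> qre p = qre q \<and> qi p = qi q \<and> qj p = qj q \<and> qk p = qk q"
  by (cases p; cases q) auto

instantiation quat :: real_algebra_1
begin

definition "0 = Quat 0 0 0 0"
definition "1 = Quat 1 0 0 0"
definition "p + q = Quat (qre p + qre q) (qi p + qi q) (qj p + qj q) (qk p + qk q)"
definition "p - q = Quat (qre p - qre q) (qi p - qi q) (qj p - qj q) (qk p - qk q)"
definition "- q = Quat (- qre q) (- qi q) (- qj q) (- qk q)"
definition "r *\<^sub>R q = Quat (r * qre q) (r * qi q) (r * qj q) (r * qk q)"
definition "p * q = Quat
  (qre p * qre q - qi p * qi q - qj p * qj q - qk p * qk q)
  (qre p * qi q + qi p * qre q + qj p * qk q - qk p * qj q)
  (qre p * qj q - qi p * qk q + qj p * qre q + qk p * qi q)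
  (qre p * qk q + qi p * qj q - qj p * qi q + qk p * qre q)"

instance
  by standard
    (simp_all add: quat_eq_iff zero_quat_def one_quat_def plus_quat_def minus_quat_def
      uminus_quat_def scaleR_quat_def times_quat_def algebra_simps)

end

lemma quat_sel_simps [simp]:
  "qre 0 = 0" "qi 0 = 0" "qj 0 = 0" "qk 0 = 0"
  "qre 1 = 1" "qi 1 = 0" "qj 1 = 0" "qk 1 = 0"
  "qre (p + q) = qre p + qre q" "qi (p + q) = qi p + qi q"
  "qj (p + q) = qj p + qj q" "qk (p + q) = qk p + qk q"
  "qre (p - q) = qre p - qre q" "qi (p - q) = qi p - qi q"
  "qj (p - q) = qj p - qj q" "qk (p - q) = qk p - qk q"
  "qre (- p) = - qre p" "qi (- p) = - qi p" "qj (- p) = - qj p" "qk (- p) = - qk p"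
  "qre (r *\<^sub>R p) = r * qre p" "qi (r *\<^sub>R p) = r * qi p"
  "qj (r *\<^sub>R p) = r * qj p" "qk (r *\<^sub>R p) = r * qk p"
  by (simp_all add: zero_quat_def one_quat_def plus_quat_def minus_quat_def uminus_quat_def
      scaleR_quat_def)

lemma quat_units:
  "Quat 0 1 0 0 * Quat 0 1 0 0 = -1" "Quat 0 0 1 0 * Quat 0 0 1 0 = -1"
  "Quat 0 0 0 1 * Quat 0 0 0 1 = -1"
  "Quat 0 1 0 0 * Quat 0 0 1 0 = Quat 0 0 0 1" "Quat 0 0 1 0 * Quat 0 0 0 1 = Quat 0 1 0 0"
  "Quat 0 0 0 1 * Quat 0 1 0 0 = Quat 0 0 1 0"
  by (simp_all add: quat_eq_iff times_quat_def)

instantiation quat :: real_inner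
begin

definition inner_quat :: "quat \<Rightarrow> quat \<Rightarrow> real" where
  "inner_quat p q = qre p * qre q + qi p * qi q + qj p * qj q + qk p * qk q"
definition norm_quat :: "quat \<Rightarrow> real" where
  "norm_quat q = sqrt (inner q q)"
definition dist_quat :: "quat \<Rightarrow> quat \<Rightarrow> real" where
  "dist_quat p q = norm (p - q)"
definition sgn_quat :: "quat \<Rightarrow> quat" where
  "sgn_quat q = q /\<^sub>R norm q"
definition uniformity_quat :: "(quat \<times> quat) filter" where
  "uniformity_quat = (INF e\<in>{0 <..}. principal {(x, y). dist x y < e})"
definition open_quat :: "quat set \<Rightarrow> bool" where
  "open_quat U \<longleftrightarrow> (\<forall>x\<in>U. eventually (\<lambda>(x', y). x' = x \<longrightarrow> y \<in> U) uniformity)"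

instance
proof
  fix p q s :: quat and r :: real
  show "inner p q = inner q p"
    by (simp add: inner_quat_def algebra_simps)
  show "inner (p + q) s = inner p s + inner q s"
    by (simp add: inner_quat_def algebra_simps)
  show "inner (r *\<^sub>R p) q = r * inner p q"
    by (simp add: inner_quat_def algebra_simps)
  show "0 \<le> inner p p"
    by (simp add: inner_quat_def)
  have "inner p p = (qre p)\<^sup>2 + (qi p)\<^sup>2 + ((qj p)\<^sup>2 + (qk p)\<^sup>2)"
    by (simp add: inner_quat_def power2_eq_square)
  then show "inner p p = 0 \<longleftrightarrow> p = 0"
    by (simp only: add_nonneg_eq_0_iff[OF sum_power2_ge_zero sum_power2_ge_zero]
        sum_power2_eq_zero_iff quat_eq_iff quat_sel_simps conj_assoc)
qed (simp_all add: norm_quat_def dist_quat_def sgn_quat_def uniformity_quat_def open_quat_def)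

end

instance quat :: real_normed_algebra_1
proof
  fix p q :: quat
  have "inner (p * q) (p * q) = inner p p * inner q q"
    unfolding inner_quat_def times_quat_def quat.sel by algebra
  then show "norm (p * q) \<le> norm p * norm q"
    by (simp add: norm_quat_def real_sqrt_mult)
  show "norm (1 :: quat) = 1"
    by (simp add: norm_quat_def inner_quat_def)
qed

instantiation quat :: euclidean_space
begin

definition Basis_quat :: "quat set" where
  "Basis_quat = {Quat 1 0 0 0, Quat 0 1 0 0, Quat 0 0 1 0, Quat 0 0 0 1}"

instance
proof
  fix u v p :: quat
  show "(Basis :: quat set) \<noteq> {}" "finite (Basis :: quat set)"
    by (simp_all add: Basis_quat_def)
  show "inner u v = (if u = v then 1 else 0)" if "u \<in> Basis" "v \<in> Basis"
    using that unfolding Basis_quat_def by (elim insertE emptyE) (simp_all add: inner_quat_def)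
  show "(\<forall>u\<in>Basis. inner p u = 0) \<longleftrightarrow> p = 0"
    by (simp add: Basis_quat_def inner_quat_def quat_eq_iff[of p 0])
qed

end

definition qcnj :: "quat \<Rightarrow> quat" where
  "qcnj q = Quat (qre q) (- qi q) (- qj q) (- qk q)"

definition quat_sphere :: "quat set" where
  "quat_sphere = {q. q\<^sup>2 = -1}"


section \<open>The spaces of square integrable quaternion-valued functions\<close>

text \<open>Elements of \<open>L2 M\<close> are functions, not classes of functions. Equality of elements of the
  Hilbert space is therefore equality almost everywhere with respect to \<open>M\<close>.\<close>

definition L2 :: "'a measure \<Rightarrow> ('a \<Rightarrow> quat) set" where
  "L2 M = {F \<in> borel_measurable M. integrable M (\<lambda>x. (norm (F x))\<^sup>2)}"

definition L2_inner :: "'a measure \<Rightarrow> ('a \<Rightarrow> quat) \<Rightarrow> ('a \<Rightarrow> quat) \<Rightarrow> quat" where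
  "L2_inner M F G = (LINT x|M. qcnj (G x) * F x)"

definition is_L2_adjoint ::
  "'a measure \<Rightarrow> 'b measure \<Rightarrow> (('a \<Rightarrow> quat) \<Rightarrow> 'b \<Rightarrow> quat) \<Rightarrow> (('b \<Rightarrow> quat) \<Rightarrow> 'a \<Rightarrow> quat) \<Rightarrow> bool"
where
  "is_L2_adjoint M N T S \<longleftrightarrow>
     T \<in> L2 M \<rightarrow> L2 N \<and> S \<in> L2 N \<rightarrow> L2 M \<and>
     (\<forall>F\<in>L2 N. \<forall>h\<in>L2 M. L2_inner M (S F) h = L2_inner N F (T h))"


section \<open>Segal-Bargmann transform and short-time Fourier transform\<close>

definition segal_bargmann :: "(real \<Rightarrow> quat) \<Rightarrow> quat \<Rightarrow> quat" where
  "segal_bargmann f q =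
     (LINT t|lborel. (2 powr (3/4)) *\<^sub>R
        exp (- (pi *\<^sub>R (q\<^sup>2 + of_real (t\<^sup>2))) + (2 * pi * sqrt 2 * t) *\<^sub>R q) * f t)"

text \<open>The transform with respect to the Gaussian window \<open>\<phi>(t) = 2\<^bsup>1/4\<^esup> e\<^bsup>-\<pi> t\<^sup>2\<^esup>\<close>; the window enters only
  through the kernel of the Segal-Bargmann transform.\<close>

definition qstft :: "quat \<Rightarrow> (real \<Rightarrow> quat) \<Rightarrow> real \<times> real \<Rightarrow> quat" where
  "qstft I f = (\<lambda>(x, \<omega>).
     let q = of_real x + \<omega> *\<^sub>R I in
       exp (- ((pi * x * \<omega>) *\<^sub>R I)) * segal_bargmann f (qcnj q /\<^sub>R sqrt 2)
         * of_real (exp (- (pi * (norm q)\<^sup>2 / 2))))"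


section \<open>The operator given by the reconstruction integral\<close>

definition synth_integrand :: "quat \<Rightarrow> (real \<times> real \<Rightarrow> quat) \<Rightarrow> real \<Rightarrow> real \<times> real \<Rightarrow> quat" where
  "synth_integrand I F y = (\<lambda>(x, \<omega>).
     exp ((2 * pi * \<omega> * y) *\<^sub>R I) * F (x, \<omega>) * of_real (exp (- (pi * (y - x)\<^sup>2))))"

definition synth_on ::
  "(real \<times> real) set \<Rightarrow> quat \<Rightarrow> (real \<times> real \<Rightarrow> quat) \<Rightarrow> real \<Rightarrow> quat" where
  "synth_on D I F y = (2 powr (3/4)) *\<^sub>R (LINT p:D|lborel. synth_integrand I F y p)"

text \<open>The integrand has modulus \<open>|F(x, \<omega>)| e\<^bsup>-\<pi> (y - x)\<^sup>2\<^esup>\<close>, with no decay in \<open>\<omega>\<close> beyond that of \<open>F\<close>.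
  For a general square integrable \<open>F\<close> the integral over the plane is thus not absolutely
  convergent, and, as for the Fourier-Plancherel transform, it is understood as the limit in the
  mean of the integrals over bounded squares, each of which converges absolutely for every \<open>y\<close>.\<close>

definition is_synth :: "quat \<Rightarrow> (real \<times> real \<Rightarrow> quat) \<Rightarrow> (real \<Rightarrow> quat) \<Rightarrow> bool" where
  "is_synth I F g \<longleftrightarrow> g \<in> L2 lborel \<and>
     (\<forall>n. synth_on (cbox (- real n, - real n) (real n, real n)) I F \<in> L2 lborel) \<and>
     (\<lambda>n. LINT y|lborel.
        (norm (synth_on (cbox (- real n, - real n) (real n, real n)) I F y - g y))\<^sup>2)
       \<longlonglongrightarrow> 0"

definition synth :: "quat \<Rightarrow> (real \<times> real \<Rightarrow> quat) \<Rightarrow> real \<Rightarrow> quat" where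
  "synth I F = (SOME g. is_synth I F g)"

end

theory Submission
  imports Defs "HOL-Probability.Probability"
begin

text \<open>
  The exponents in the definition of the transform combine to
  \<open>V f(x, \<omega>) = 2\<^bsup>3/4\<^esup> \<integral> e\<^bsup>-\<pi>(t - x)\<^sup>2\<^esup> e\<^bsup>-2\<pi>I\<omega>t\<^esup> f(t) dt\<close>. Inserting a factor \<open>e\<^bsup>-\<pi>\<epsilon>\<^sup>2\<omega>\<^sup>2\<^esup>\<close> into \<open>\<langle>V f, V h\<rangle>\<close> makes
  Fubini applicable; integrating out \<open>x\<close> and \<open>\<omega>\<close> leaves \<open>2 \<integral>\<integral> K\<^sub>\<epsilon>(s - t) cnj (h s) f(t) ds dt\<close>
  with a \<^emph>\<open>real\<close> approximate identity \<open>K\<^sub>\<epsilon>\<close>, so noncommutativity plays no role. For \<open>h = f\<close> and \<open>\<epsilon> \<rightarrow> 0\<close>,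
  Fatou's lemma gives \<open>\<parallel>V f\<parallel>\<^sup>2 \<le> 2 \<parallel>f\<parallel>\<^sup>2\<close>. For \<open>h\<close> the indicator of an interval, dominated convergence
  gives \<open>\<langle>V f, V h\<rangle> = 2 \<langle>f, h\<rangle>\<close>; since intervals separate functions up to null sets, \<open>V\<^sup>* V = 2\<close>.
  Duality with the bound for \<open>V\<close> bounds the synthesis integral on integrable \<open>F\<close>, so its truncations to
  squares are Cauchy for every square integrable \<open>F\<close>, and the limit is the adjoint.
\<close>

section \<open>Quaternion algebra and the complex slice\<close>

lemma qcnj_simps [simp]:
  "qre (qcnj q) = qre q" "qi (qcnj q) = - qi q" "qj (qcnj q) = - qj q" "qk (qcnj q) = - qk q"
  by (simp_all add: qcnj_def)

lemma quat_mult_sel: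
  "qre (p * q) = qre p * qre q - qi p * qi q - qj p * qj q - qk p * qk q"
  "qi (p * q) = qre p * qi q + qi p * qre q + qj p * qk q - qk p * qj q"
  "qj (p * q) = qre p * qj q - qi p * qk q + qj p * qre q + qk p * qi q"
  "qk (p * q) = qre p * qk q + qi p * qj q - qj p * qi q + qk p * qre q"
  by (simp_all add: times_quat_def)

text \<open>Euler's four-square identity. The type class provides only submultiplicativity; equality
  makes the norms of the integrands below explicit.\<close>

lemma norm_quat_mult: "norm (p * q :: quat) = norm p * norm q"
proof -
  have "inner (p * q) (p * q) = inner p p * inner q q"
    unfolding inner_quat_def times_quat_def quat.sel by algebra
  then show ?thesis
    by (simp add: norm_quat_def real_sqrt_mult)
qed

lemma norm_qcnj [simp]: "norm (qcnj q) = norm q"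
  by (simp add: norm_quat_def inner_quat_def)

lemma qcnj_1 [simp]: "qcnj 1 = 1"
  by (simp add: quat_eq_iff)

lemma qcnj_mult: "qcnj (p * q) = qcnj q * qcnj p"
  by (simp add: quat_eq_iff quat_mult_sel)

lemma qcnj_mult_self: "qcnj q * q = of_real ((norm q)\<^sup>2)"
  unfolding power2_norm_eq_inner
  by (simp add: quat_eq_iff quat_mult_sel of_real_def inner_quat_def)

lemma bounded_linear_qcnj: "bounded_linear qcnj"
  by (rule bounded_linear_intro[where K = 1]) (simp_all add: quat_eq_iff)

lemmas qcnj_scaleR = linear_scale[OF bounded_linear.linear[OF bounded_linear_qcnj]]

lemma borel_measurable_qcnj [measurable]: "qcnj \<in> borel_measurable borel"
  by (intro borel_measurable_continuous_onI linear_continuous_on bounded_linear_qcnj)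

text \<open>The imaginary components of \<open>I * I\<close> are those of \<open>I\<close> times
  \<open>2 * qre I\<close>. A nonzero real part would therefore make \<open>I\<close> real, and no
  real number has square -1.\<close>

lemma quat_sphere_qcnj:
  assumes "I \<in> quat_sphere"
  shows "qcnj I = - I"
proof -
  from assms have "I * I = - 1"
    by (simp add: quat_sphere_def power2_eq_square)
  then have e: "qre I * qre I - qi I * qi I - qj I * qj I - qk I * qk I = -1"
    "2 * (qre I * qi I) = 0" "2 * (qre I * qj I) = 0" "2 * (qre I * qk I) = 0"
    by (auto simp add: quat_eq_iff quat_mult_sel)
  have "qre I = 0"
  proof (rule ccontr)
    assume "qre I \<noteq> 0"
    with e have "qre I * qre I = -1" by simp
    then show False by (metis neg_0_le_iff_le not_one_le_zero zero_le_square)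
  qed
  then show ?thesis
    by (simp add: quat_eq_iff)
qed

text \<open>For \<open>I\<close> in \<open>quat_sphere\<close> this embeds the complex numbers as
  the commutative slice spanned by 1 and \<open>I\<close>. Identities between exponentials are
  proved in the complex numbers and carried over.\<close>

definition quat_of_complex :: "quat \<Rightarrow> complex \<Rightarrow> quat" where
  "quat_of_complex I z = of_real (Re z) + Im z *\<^sub>R I"

lemma bounded_linear_quat_of_complex: "bounded_linear (quat_of_complex I)"
  unfolding quat_of_complex_def of_real_def
  by (intro bounded_linear_add bounded_linear_scaleR_const bounded_linear_Re bounded_linear_Im
      bounded_linear_compose[OF bounded_linear_scaleR_left])

lemmas quat_of_complex_add = linear_add[OF bounded_linear.linear[OF bounded_linear_quat_of_complex]]
lemmas quat_of_complex_scaleR = linear_scale[OF bounded_linear.linear[OF bounded_linear_quat_of_complex]]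

lemma quat_of_complex_of_real [simp]: "quat_of_complex I (of_real r) = of_real r"
  by (simp add: quat_of_complex_def)

lemma quat_of_complex_1 [simp]: "quat_of_complex I 1 = 1"
  by (simp add: quat_of_complex_def)

lemma quat_of_complex_mult:
  assumes "I \<in> quat_sphere"
  shows "quat_of_complex I (z * w) = quat_of_complex I z * quat_of_complex I w"
proof -
  have I: "I * I = - 1"
    using assms by (simp add: quat_sphere_def power2_eq_square)
  have "quat_of_complex I z * quat_of_complex I w = (Re z * Re w) *\<^sub>R 1 + (Re z * Im w + Im z * Re w) *\<^sub>R I
      + (Im z * Im w) *\<^sub>R (I * I)"
    by (simp add: quat_of_complex_def of_real_def algebra_simps)
  then show ?thesis
    by (simp add: I quat_of_complex_def of_real_def algebra_simps)
qed

lemma quat_of_complex_power: "I \<in> quat_sphere \<Longrightarrow> quat_of_complex I (z ^ n) = quat_of_complex I z ^ n"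
  by (induction n) (simp_all add: quat_of_complex_mult)

text \<open>The embedding is bounded linear and multiplicative, so it can be applied to the
  exponential series term by term.\<close>

lemma quat_of_complex_exp:
  assumes "I \<in> quat_sphere"
  shows "quat_of_complex I (exp z) = exp (quat_of_complex I z)"
proof -
  have "(\<lambda>n. quat_of_complex I (z ^ n /\<^sub>R fact n)) sums quat_of_complex I (exp z)"
    by (rule bounded_linear.sums[OF bounded_linear_quat_of_complex exp_converges])
  then have "(\<lambda>n. quat_of_complex I z ^ n /\<^sub>R fact n) sums quat_of_complex I (exp z)"
    by (simp add: quat_of_complex_scaleR quat_of_complex_power[OF assms])
  from this exp_converges show ?thesis
    by (rule sums_unique2)
qed

lemma qcnj_quat_of_complex: "I \<in> quat_sphere \<Longrightarrow> qcnj (quat_of_complex I z) = quat_of_complex I (cnj z)"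
  using quat_sphere_qcnj[of I] by (simp add: quat_of_complex_def quat_eq_iff of_real_def)

lemma norm_quat_of_complex: "I \<in> quat_sphere \<Longrightarrow> norm (quat_of_complex I z) = norm z"
proof -
  assume I: "I \<in> quat_sphere"
  have "(of_real ((norm (quat_of_complex I z))\<^sup>2) :: quat) = quat_of_complex I (cnj z * z)"
    unfolding qcnj_mult_self[symmetric] by (simp add: qcnj_quat_of_complex quat_of_complex_mult I)
  also have "\<dots> = of_real ((norm z)\<^sup>2)"
    by (metis complex_norm_square quat_of_complex_of_real mult.commute)
  finally show ?thesis
    by (simp add: power2_eq_iff_nonneg del: of_real_power)
qed

definition qexp :: "quat \<Rightarrow> real \<Rightarrow> quat" where
  "qexp I \<theta> = exp (\<theta> *\<^sub>R I)"

lemma qexp_quat_of_complex: "I \<in> quat_sphere \<Longrightarrow> qexp I \<theta> = quat_of_complex I (cis \<theta>)"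
  by (simp add: qexp_def cis_conv_exp quat_of_complex_exp) (simp add: quat_of_complex_def)

lemma qexp_add: "I \<in> quat_sphere \<Longrightarrow> qexp I (a + b) = qexp I a * qexp I b"
  by (simp add: qexp_quat_of_complex cis_mult[symmetric] quat_of_complex_mult)

lemma norm_qexp [simp]: "I \<in> quat_sphere \<Longrightarrow> norm (qexp I \<theta>) = 1"
  by (simp add: qexp_quat_of_complex norm_quat_of_complex)

lemma qcnj_qexp: "I \<in> quat_sphere \<Longrightarrow> qcnj (qexp I \<theta>) = qexp I (- \<theta>)"
  by (simp add: qexp_quat_of_complex qcnj_quat_of_complex cis_cnj)

lemma borel_measurable_qexp [measurable]: "qexp I \<in> borel_measurable borel"
proof (intro borel_measurable_continuous_onI)
  have "continuous_on UNIV (\<lambda>\<theta>. exp (\<theta> *\<^sub>R I))"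
    unfolding continuous_on_eq_continuous_within
    by (blast intro: has_vector_derivative_continuous exp_scaleR_has_vector_derivative_right)
  then show "continuous_on UNIV (qexp I)"
    by (simp add: qexp_def[abs_def])
qed

section \<open>Gaussian integrals\<close>

text \<open>In this normalisation the Gaussian has integral 1 and is its own Fourier
  transform.\<close>

definition gauss :: "real \<Rightarrow> real" where
  "gauss x = exp (- (pi * x\<^sup>2))"

lemma gauss_nonneg [simp]: "0 \<le> gauss x"
  and gauss_le_1 [simp]: "gauss x \<le> 1" and gauss_minus [simp]: "gauss (- x) = gauss x"
  and gauss_0 [simp]: "gauss 0 = 1"
  by (simp_all add: gauss_def)

lemma borel_measurable_gauss [measurable]: "gauss \<in> borel_measurable borel"
  unfolding gauss_def by measurable

lemma continuous_gauss: "isCont gauss x"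
  unfolding gauss_def by (intro continuous_intros)

lemma gauss_normal_density: "gauss x = normal_density 0 (1 / sqrt (2 * pi)) x"
  by (simp add: gauss_def normal_density_def power_divide field_simps)

lemma has_bochner_integral_gauss:
  assumes "c \<noteq> 0"
  shows "has_bochner_integral lborel (\<lambda>x. gauss (c * x + d)) (1 / \<bar>c\<bar>)"
proof -
  have "has_bochner_integral lborel gauss 1"
    unfolding gauss_normal_density[abs_def] has_bochner_integral_iff by simp
  then have "has_bochner_integral lborel (\<lambda>x. gauss (d + c * x)) (1 /\<^sub>R \<bar>c\<bar>)"
    by (subst lborel_has_bochner_integral_real_affine_iff[of c _ _ d, symmetric])
      (use assms in simp_all)
  then show ?thesis
    by (simp add: add.commute divide_inverse)
qed

lemmas integrable_gauss = integrable.intros[OF has_bochner_integral_gauss]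
lemmas integral_gauss = has_bochner_integral_integral_eq[OF has_bochner_integral_gauss]

text \<open>Completing the square in \<open>x\<close>: one factor depends on \<open>s - t\<close>
  alone, and the other is a Gaussian in \<open>x\<close> centred at the midpoint of \<open>s\<close>
  and \<open>t\<close>, so its integral over \<open>x\<close> depends on neither.\<close>

lemma gauss_mult_gauss:
  "gauss (s - x) * gauss (t - x) = gauss ((s - t) / sqrt 2) * gauss (sqrt 2 * x + (- (s + t) / sqrt 2))"
proof -
  have "(s - x)\<^sup>2 + (t - x)\<^sup>2 = ((s - t) / sqrt 2)\<^sup>2 + (sqrt 2 * x + (- (s + t) / sqrt 2))\<^sup>2"
    by (simp add: power2_diff power2_sum power_divide power_mult_distrib field_simps)
  then show ?thesis
    by (simp add: gauss_def exp_add[symmetric] distrib_left[symmetric] del: mult_minus_right)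
       (metis add_uminus_conv_diff distrib_left minus_add_distrib)
qed

text \<open>The Fourier transform of a Gaussian, read off from the characteristic function of the
  standard normal distribution by rescaling.\<close>

lemma has_bochner_integral_cis_gauss:
  assumes e: "e > 0"
  shows "has_bochner_integral lborel (\<lambda>w. gauss (e * w) *\<^sub>R cis (2 * pi * r * w))
    (of_real (gauss (r / e) / e))"
proof -
  \<comment> \<open>The substitution \<open>x = ?c * w\<close> turns \<open>exp (- x^2 / 2)\<close>
    into \<open>gauss (e * w)\<close>, and \<open>?t\<close> is fixed by
    \<open>?t * ?c = 2 * pi * r\<close>. The factor \<open>sqrt (2 * pi)\<close> used below cancels
    the normalising constant of the density.\<close>
  let ?c = "sqrt (2 * pi) * e" and ?t = "sqrt (2 * pi) * r / e"
  let ?f = "\<lambda>x. std_normal_density x *\<^sub>R iexp (?t * x)"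
  have int: "integrable lborel ?f"
    by (rule Bochner_Integration.integrable_bound[of _ std_normal_density]) 
       (simp_all add: normal_density_nonneg)
  have "integral\<^sup>L lborel ?f = char std_normal_distribution ?t"
    unfolding char_def
    by (subst integral_density) (simp_all add: normal_density_nonneg)
  also have "\<dots> = of_real (gauss (r / e))"
    unfolding char_std_normal_distribution gauss_def
    by (simp add: power_mult_distrib power_divide)
  finally have "has_bochner_integral lborel ?f (of_real (gauss (r / e)))"
    using int by (simp add: has_bochner_integral_iff)
  then have "has_bochner_integral lborel (\<lambda>x. ?f (0 + ?c * x)) (of_real (gauss (r / e)) /\<^sub>R \<bar>?c\<bar>)"
    by (subst lborel_has_bochner_integral_real_affine_iff[symmetric]) (use e in simp_all)
  then have "has_bochner_integral lborel (\<lambda>x. sqrt (2 * pi) *\<^sub>R ?f (0 + ?c * x))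
    (sqrt (2 * pi) *\<^sub>R (of_real (gauss (r / e)) /\<^sub>R \<bar>?c\<bar>))"
    by (intro has_bochner_integral_scaleR_right)
  moreover have "sqrt (2 * pi) *\<^sub>R ?f (0 + ?c * x) = gauss (e * x) *\<^sub>R cis (2 * pi * r * x)" for x
  proof -
    have "?t * (?c * x) = 2 * pi * r * x"
      using e by (simp add: field_simps)
    then show ?thesis
      by (simp add: normal_density_def gauss_def cis_conv_exp power_mult_distrib real_sqrt_mult)
  qed
  moreover have "sqrt (2 * pi) *\<^sub>R (of_real (gauss (r / e)) /\<^sub>R \<bar>?c\<bar>) = (of_real (gauss (r / e) / e) :: complex)"
    using e by (simp add: scaleR_conv_of_real field_simps abs_mult)
  ultimately show ?thesis
    by simp
qed

text \<open>The value of the frequency integral is real and hence central, so it can later be moved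
  past quaternion-valued factors.\<close>

lemma has_bochner_integral_qexp_gauss:
  assumes "I \<in> quat_sphere" "e > 0"
  shows "has_bochner_integral lborel (\<lambda>w. gauss (e * w) *\<^sub>R qexp I (2 * pi * r * w))
    (of_real (gauss (r / e) / e))"
  using has_bochner_integral_bounded_linear[OF bounded_linear_quat_of_complex has_bochner_integral_cis_gauss[OF assms(2)], of I r]
  by (simp add: quat_of_complex_scaleR qexp_quat_of_complex assms(1) del: of_real_divide)

section \<open>The space of square integrable functions\<close>

lemma L2_measurable: "F \<in> L2 M \<Longrightarrow> F \<in> borel_measurable M"
  and L2_integrable_norm2: "F \<in> L2 M \<Longrightarrow> integrable M (\<lambda>x. (norm (F x))\<^sup>2)"
  by (simp_all add: L2_def)

lemma norm2_add_le: "(norm (a + b))\<^sup>2 \<le> 2 * (norm a)\<^sup>2 + 2 * (norm b :: real)\<^sup>2"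
  for a b :: "'a::real_normed_vector"
proof -
  have "(norm (a + b))\<^sup>2 \<le> (norm a + norm b)\<^sup>2"
    by (intro power_mono norm_triangle_ineq) simp
  also have "\<dots> \<le> 2 * (norm a)\<^sup>2 + 2 * (norm b)\<^sup>2"
    using sum_squares_bound[of "norm a" "norm b"] by (simp add: power2_sum)
  finally show ?thesis .
qed

lemma norm2_diff_le: "(norm (a - b))\<^sup>2 \<le> 2 * (norm a)\<^sup>2 + 2 * (norm b :: real)\<^sup>2"
  for a b :: "'a::real_normed_vector"
  using norm2_add_le[of a "- b"] by simp

lemma L2I:
  assumes "F \<in> borel_measurable M" "integrable M g" "AE x in M. (norm (F x))\<^sup>2 \<le> g x"
  shows "F \<in> L2 M"
proof -
  have "integrable M (\<lambda>x. (norm (F x))\<^sup>2)"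
    by (rule Bochner_Integration.integrable_bound[OF assms(2)])
      (use assms in auto)
  with assms(1) show ?thesis
    by (simp add: L2_def)
qed

text \<open>Dominates a square integrable function by an integrable one on sets of finite measure or
  against a bounded integrable weight.\<close>

lemma norm_le_1_plus_norm2: "norm a \<le> 1 + (norm (a :: 'a::real_normed_vector))\<^sup>2"
  using sum_squares_bound[of 1 "norm a"] norm_ge_zero[of a] unfolding power_one mult_1_right by linarith

lemma L2_diff: "F \<in> L2 M \<Longrightarrow> G \<in> L2 M \<Longrightarrow> (\<lambda>x. F x - G x) \<in> L2 M"
  by (rule L2I[where g = "\<lambda>x. 2 * (norm (F x))\<^sup>2 + 2 * (norm (G x))\<^sup>2"])
    (auto simp: norm2_diff_le L2_def)

lemma L2_scaleR: "F \<in> L2 M \<Longrightarrow> (\<lambda>x. c *\<^sub>R F x) \<in> L2 M"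
  by (auto simp: L2_def power_mult_distrib)

lemma L2_indicator:
  assumes "F \<in> L2 M" "D \<in> sets M"
  shows "(\<lambda>x. indicator D x *\<^sub>R F x) \<in> L2 M"
  by (rule L2I[where g = "\<lambda>x. (norm (F x))\<^sup>2"])
    (use assms in \<open>auto simp: L2_def indicator_def\<close>)

lemma L2_integrable_mult:
  assumes "F \<in> L2 M" "G \<in> L2 M"
  shows "integrable M (\<lambda>x. norm (F x) * norm (G x))"
proof (rule Bochner_Integration.integrable_bound)
  have [measurable]: "F \<in> borel_measurable M" "G \<in> borel_measurable M"
    using assms by (auto dest: L2_measurable)
  show "integrable M (\<lambda>x. (norm (F x))\<^sup>2 + (norm (G x))\<^sup>2)"
    using assms by (simp add: L2_def)
  show "(\<lambda>x. norm (F x) * norm (G x)) \<in> borel_measurable M"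
    by measurable
  have "norm (F x) * norm (G x) \<le> (norm (F x))\<^sup>2 + (norm (G x))\<^sup>2" for x
    using sum_squares_bound[of "norm (F x)" "norm (G x)"]
      mult_nonneg_nonneg[OF norm_ge_zero norm_ge_zero, of "F x" "G x"] by linarith
  then show "AE x in M. norm (norm (F x) * norm (G x)) \<le> norm ((norm (F x))\<^sup>2 + (norm (G x))\<^sup>2)"
    by simp
qed

lemma L2_integrable_inner:
  assumes "F \<in> L2 M" "G \<in> L2 M"
  shows "integrable M (\<lambda>x. qcnj (G x) * F x)"
  using L2_integrable_mult[OF assms(2,1)]
  by (rule Bochner_Integration.integrable_bound)
    (use assms in \<open>auto simp: L2_def norm_quat_mult intro!: borel_measurable_times\<close>)

lemma L2_inner_self: "F \<in> L2 M \<Longrightarrow> L2_inner M F F = of_real (LINT x|M. (norm (F x))\<^sup>2)"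
  by (simp add: L2_inner_def qcnj_mult_self L2_def of_real_def del: of_real_power)

lemma L2_inner_diff_left:
  "F \<in> L2 M \<Longrightarrow> G \<in> L2 M \<Longrightarrow> H \<in> L2 M \<Longrightarrow>
    L2_inner M (\<lambda>x. F x - G x) H = L2_inner M F H - L2_inner M G H"
  by (simp add: L2_inner_def right_diff_distrib L2_integrable_inner)

lemma L2_Cauchy_Schwarz:
  assumes F: "F \<in> L2 M" and G: "G \<in> L2 M"
  shows "(LINT x|M. norm (F x) * norm (G x))\<^sup>2 \<le> (LINT x|M. (norm (F x))\<^sup>2) * (LINT x|M. (norm (G x))\<^sup>2)"
proof -
  have [measurable]: "F \<in> borel_measurable M" "G \<in> borel_measurable M"
    using F G by (auto dest: L2_measurable)
  have "(\<integral>\<^sup>+x. ennreal (norm (F x)) * ennreal (norm (G x)) \<partial>M)\<^sup>2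
      \<le> (\<integral>\<^sup>+x. (ennreal (norm (F x)))\<^sup>2 \<partial>M) * (\<integral>\<^sup>+x. (ennreal (norm (G x)))\<^sup>2 \<partial>M)"
    by (rule Cauchy_Schwarz_nn_integral) measurable
  then show ?thesis
    using L2_integrable_norm2[OF F] L2_integrable_norm2[OF G] L2_integrable_mult[OF F G]
    by (simp add: ennreal_mult[symmetric] ennreal_power nn_integral_eq_integral)
qed

lemma L2_inner_bound:
  assumes F: "F \<in> L2 M" and G: "G \<in> L2 M"
  shows "(norm (L2_inner M F G))\<^sup>2 \<le> (LINT x|M. (norm (F x))\<^sup>2) * (LINT x|M. (norm (G x))\<^sup>2)"
proof -
  have "norm (L2_inner M F G) \<le> (LINT x|M. norm (qcnj (G x) * F x))"
    unfolding L2_inner_def by (rule integral_norm_bound)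
  also have "\<dots> = (LINT x|M. norm (F x) * norm (G x))"
    by (simp add: norm_quat_mult mult.commute)
  finally have "(norm (L2_inner M F G))\<^sup>2 \<le> (LINT x|M. norm (F x) * norm (G x))\<^sup>2"
    by (rule power_mono) simp
  also note L2_Cauchy_Schwarz[OF F G]
  finally show ?thesis .
qed

lemma L2_inner_tendsto:
  assumes u: "\<And>n. u n \<in> L2 M" and g: "g \<in> L2 M" and h: "h \<in> L2 M"
    and lim: "(\<lambda>n. LINT x|M. (norm (u n x - g x))\<^sup>2) \<longlonglongrightarrow> 0"
  shows "(\<lambda>n. L2_inner M (u n) h) \<longlonglongrightarrow> L2_inner M g h"
proof -
  have "(\<lambda>n. (LINT x|M. (norm (u n x - g x))\<^sup>2) * (LINT x|M. (norm (h x))\<^sup>2)) \<longlonglongrightarrow> 0"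
    using tendsto_mult_left_zero[OF lim] .
  then have "(\<lambda>n. (norm (L2_inner M (u n) h - L2_inner M g h))\<^sup>2) \<longlonglongrightarrow> 0"
    by (rule Lim_null_comparison[rotated])
      (auto simp: L2_inner_diff_left[symmetric] u g h intro!: always_eventually L2_inner_bound L2_diff)
  then have "(\<lambda>n. norm (L2_inner M (u n) h - L2_inner M g h)) \<longlonglongrightarrow> 0"
    by (drule_tac tendsto_real_sqrt) simp
  then show ?thesis
    by (simp add: tendsto_norm_zero_iff LIM_zero_iff)
qed

section \<open>Fatou's lemma and completeness of the space of square integrable functions\<close>

lemma integral_Fatou:
  fixes u :: "nat \<Rightarrow> 'a \<Rightarrow> real"
  assumes int: "\<And>n. integrable M (u n)" and nonneg: "\<And>n x. 0 \<le> u n x"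
    and v [measurable]: "v \<in> borel_measurable M"
    and lim: "AE x in M. (\<lambda>n. u n x) \<longlonglongrightarrow> v x" and bound: "\<forall>\<^sub>F n in sequentially. integral\<^sup>L M (u n) \<le> C"
    and C: "0 \<le> C"
  shows "integrable M v" "integral\<^sup>L M v \<le> C"
proof -
  have [measurable]: "u n \<in> borel_measurable M" for n
    using int by auto
  have v_nonneg: "AE x in M. 0 \<le> v x"
    using lim by eventually_elim (auto intro: LIMSEQ_le_const nonneg)
  have "(\<integral>\<^sup>+x. ennreal (v x) \<partial>M) = (\<integral>\<^sup>+x. liminf (\<lambda>n. ennreal (u n x)) \<partial>M)"
  proof (rule nn_integral_cong_AE)
    show "AE x in M. ennreal (v x) = liminf (\<lambda>n. ennreal (u n x))"
      using lim
      by eventually_elim (simp add: lim_imp_Liminf[OF sequentially_bot tendsto_ennrealI])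
  qed
  also have "\<dots> \<le> liminf (\<lambda>n. \<integral>\<^sup>+x. ennreal (u n x) \<partial>M)"
    by (rule nn_integral_liminf) measurable
  also have "\<dots> = liminf (\<lambda>n. ennreal (integral\<^sup>L M (u n)))"
    by (simp add: nn_integral_eq_integral int nonneg)
  also have "\<dots> \<le> liminf (\<lambda>n. ennreal C)"
    using bound by (intro Liminf_mono) (auto elim: eventually_mono intro: ennreal_leI)
  finally have le: "(\<integral>\<^sup>+x. ennreal (v x) \<partial>M) \<le> ennreal C"
    by (simp add: Liminf_const)
  show "integrable M v"
    using v_nonneg le by (intro integrableI_nonneg) (auto simp: less_top[symmetric] top_unique)
  then have "ennreal (integral\<^sup>L M v) \<le> ennreal C"
    using le v_nonneg by (simp add: nn_integral_eq_integral)
  then show "integral\<^sup>L M v \<le> C"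
    using C by (simp add: ennreal_le_iff)
qed

text \<open>The Riesz-Fischer argument: a subsequence with rapidly decreasing increments converges
  almost everywhere, and Fatou's lemma along it upgrades the pointwise limit to a limit in the mean
  of the whole sequence.\<close>

lemma L2_complete:
  assumes u: "\<And>n. u n \<in> L2 M"
    and cauchy: "\<And>e. 0 < e \<Longrightarrow> \<exists>N. \<forall>m\<ge>N. \<forall>n\<ge>N. (LINT x|M. (norm (u m x - u n x))\<^sup>2) \<le> e"
  obtains g where "g \<in> L2 M" "(\<lambda>n. LINT x|M. (norm (u n x - g x))\<^sup>2) \<longlonglongrightarrow> 0"
proof -
  have [measurable]: "u n \<in> borel_measurable M" for n
    using u by (rule L2_measurable)
  \<comment> \<open>Squared distances of at most \<open>(1/4)^k\<close> stay summable after
    weighting by \<open>2^k\<close>; the weight later turns control of squared increments into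
    control of the increments themselves.\<close>
  have "\<exists>N. \<forall>m\<ge>N. \<forall>n\<ge>N. (LINT x|M. (norm (u m x - u n x))\<^sup>2) \<le> (1/4)^k" for k
    by (rule cauchy) simp
  then obtain N where N: "\<And>k m n. N k \<le> m \<Longrightarrow> N k \<le> n \<Longrightarrow> (LINT x|M. (norm (u m x - u n x))\<^sup>2) \<le> (1/4)^k"
    by metis
  \<comment> \<open>The sum makes \<open>r k\<close> at least \<open>N k\<close>, and the summand
    \<open>k\<close> makes \<open>r\<close> strictly increasing.\<close>
  define r where "r k = (\<Sum>i\<le>k. N i) + k" for k
  have r: "strict_mono r"
    by (simp add: strict_mono_Suc_iff r_def)
  have r_ge: "N k \<le> r k" for k
    unfolding r_def using member_le_sum[of k "{..k}" N] by simp
  define d where "d k x = u (r (Suc k)) x - u (r k) x" for k x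
  have d_L2: "d k \<in> L2 M" for k
    unfolding d_def[abs_def] by (intro L2_diff u)
  have d_int: "(LINT x|M. (norm (d k x))\<^sup>2) \<le> (1/4)^k" for k
    unfolding d_def using r by (intro N r_ge order_trans[OF r_ge, of k]) (simp_all add: strict_mono_leD)
  have "(\<integral>\<^sup>+x. (\<Sum>k. ennreal (2 ^ k * (norm (d k x))\<^sup>2)) \<partial>M)
      = (\<Sum>k. \<integral>\<^sup>+x. ennreal (2 ^ k * (norm (d k x))\<^sup>2) \<partial>M)"
    unfolding d_def by (rule nn_integral_suminf) measurable
  also have "\<dots> \<le> (\<Sum>k. ennreal ((1/2) ^ k))"
  proof (intro suminf_le summableI)
    fix k
    have "(\<integral>\<^sup>+x. ennreal (2 ^ k * (norm (d k x))\<^sup>2) \<partial>M) = ennreal (2 ^ k * (LINT x|M. (norm (d k x))\<^sup>2))"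
      using L2_integrable_norm2[OF d_L2] by (subst nn_integral_eq_integral) simp_all
    also have "\<dots> \<le> ennreal (2 ^ k * (1/4) ^ k)"
      by (intro ennreal_leI mult_left_mono d_int) simp
    also have "2 ^ k * (1/4 :: real) ^ k = (1/2) ^ k"
      by (simp flip: power_mult_distrib)
    finally show "(\<integral>\<^sup>+x. ennreal (2 ^ k * (norm (d k x))\<^sup>2) \<partial>M) \<le> ennreal ((1/2) ^ k)" .
  qed
  also have "\<dots> < \<infinity>"
    by (simp add: suminf_ennreal2 less_top[symmetric] summable_geometric)
  finally have "(\<integral>\<^sup>+x. (\<Sum>k. ennreal (2 ^ k * (norm (d k x))\<^sup>2)) \<partial>M) \<noteq> \<infinity>"
    by simp
  moreover have "(\<lambda>x. \<Sum>k. ennreal (2 ^ k * (norm (d k x))\<^sup>2)) \<in> borel_measurable M"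
    unfolding d_def by measurable
  ultimately have "AE x in M. (\<Sum>k. ennreal (2 ^ k * (norm (d k x))\<^sup>2)) \<noteq> \<infinity>"
    by (intro nn_integral_PInf_AE)
  then have conv: "AE x in M. convergent (\<lambda>k. u (r k) x)"
  proof eventually_elim
    fix x assume "(\<Sum>k. ennreal (2 ^ k * (norm (d k x))\<^sup>2)) \<noteq> \<infinity>"
    then have "summable (\<lambda>k. 2 ^ k * (norm (d k x))\<^sup>2)"
      by (intro summable_suminf_not_top) simp_all
    then have "summable (\<lambda>k. (1/2) ^ k + 2 ^ k * (norm (d k x))\<^sup>2)"
      by (intro summable_add summable_geometric) simp_all
    then have "summable (\<lambda>k. d k x)"
    proof (rule summable_comparison_test'[where N = 0])
      fix k
      \<comment> \<open>Completing the square bounds the norm of the increment by a geometric term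
        plus its weighted square.\<close>
      have "0 \<le> (2 ^ k * norm (d k x) - 1)\<^sup>2 / 2 ^ k + norm (d k x)"
        by simp
      also have "\<dots> = (1/2) ^ k + 2 ^ k * (norm (d k x))\<^sup>2 - norm (d k x)"
        by (simp add: power2_diff power_mult_distrib field_simps power_divide power2_eq_square)
      finally show "norm (d k x) \<le> (1/2) ^ k + 2 ^ k * (norm (d k x))\<^sup>2"
        by simp
    qed
    then have "convergent (\<lambda>n. \<Sum>k<n. d k x)"
      by (simp add: summable_iff_convergent)
    then have "convergent (\<lambda>n. u (r 0) x + (\<Sum>k<n. d k x))"
      by (intro convergent_add convergent_const)
    also have "(\<lambda>n. u (r 0) x + (\<Sum>k<n. d k x)) = (\<lambda>k. u (r k) x)"
      using sum_lessThan_telescope[of "\<lambda>k. u (r k) x"] by (simp add: d_def fun_eq_iff)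
    finally show "convergent (\<lambda>k. u (r k) x)" .
  qed
  \<comment> \<open>Where the subsequence diverges, \<open>lim\<close> has an unspecified value; by
    \<open>conv\<close> this happens only on a null set.\<close>
  define g where "g x = lim (\<lambda>k. u (r k) x)" for x
  have [measurable]: "g \<in> borel_measurable M"
    unfolding g_def[abs_def] by measurable
  have lim: "AE x in M. (\<lambda>k. u (r k) x) \<longlonglongrightarrow> g x"
    using conv by eventually_elim (simp add: g_def convergent_LIMSEQ_iff)
  \<comment> \<open>The index \<open>n\<close> stays fixed while the second index runs through the
    subsequence \<open>r\<close>, where the integrands converge almost everywhere.\<close>
  have fatou: "integrable M (\<lambda>x. (norm (u n x - g x))\<^sup>2)" "(LINT x|M. (norm (u n x - g x))\<^sup>2) \<le> e"
    if n: "n \<ge> N" and N: "\<And>m. m \<ge> N \<Longrightarrow> (LINT x|M. (norm (u n x - u m x))\<^sup>2) \<le> e" and "0 \<le> e" for n N e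
  proof -
    have ev: "\<forall>\<^sub>F k in sequentially. (LINT x|M. (norm (u n x - u (r k) x))\<^sup>2) \<le> e"
      using eventually_ge_at_top[of N]
      by eventually_elim (auto intro!: N order_trans[OF _ seq_suble[OF r]])
    have "AE x in M. (\<lambda>k. (norm (u n x - u (r k) x))\<^sup>2) \<longlonglongrightarrow> (norm (u n x - g x))\<^sup>2"
      using lim by eventually_elim (intro tendsto_intros)
    from integral_Fatou[OF _ _ _ this ev]
    show "integrable M (\<lambda>x. (norm (u n x - g x))\<^sup>2)" "(LINT x|M. (norm (u n x - g x))\<^sup>2) \<le> e"
      using \<open>0 \<le> e\<close> by (simp_all add: L2_integrable_norm2[OF L2_diff[OF u u]])
  qed
  have g: "g \<in> L2 M"
  proof -
    obtain N where "\<forall>m\<ge>N. \<forall>n\<ge>N. (LINT x|M. (norm (u m x - u n x))\<^sup>2) \<le> 1"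
      using cauchy[of 1] by auto
    then have "integrable M (\<lambda>x. (norm (u N x - g x))\<^sup>2)"
      by (intro fatou(1)[of N N 1]) auto
    then have "(\<lambda>x. u N x - g x) \<in> L2 M"
      by (simp add: L2_def)
    from L2_diff[OF u[of N] this] show ?thesis
      by simp
  qed
  moreover have "(\<lambda>n. LINT x|M. (norm (u n x - g x))\<^sup>2) \<longlonglongrightarrow> 0"
  proof (rule LIMSEQ_I)
    fix e :: real assume "0 < e"
    then obtain N where N: "\<forall>m\<ge>N. \<forall>n\<ge>N. (LINT x|M. (norm (u m x - u n x))\<^sup>2) \<le> e / 2"
      using cauchy[of "e / 2"] by auto
    have "(LINT x|M. (norm (u n x - g x))\<^sup>2) \<le> e / 2" if "n \<ge> N" for n
      using N that \<open>0 < e\<close> by (intro fatou(2)) auto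
    then show "\<exists>N. \<forall>n\<ge>N. norm ((LINT x|M. (norm (u n x - g x))\<^sup>2) - 0) < e"
      using \<open>0 < e\<close> by (intro exI[of _ N]) fastforce
  qed
  ultimately show ?thesis
    by (rule that)
qed

lemma L2_AE_subseq:
  assumes u: "\<And>n. u n \<in> L2 M" and g: "g \<in> L2 M"
    and lim: "(\<lambda>n. LINT x|M. (norm (u n x - g x))\<^sup>2) \<longlonglongrightarrow> 0"
  obtains r :: "nat \<Rightarrow> nat" where "strict_mono r" "AE x in M. (\<lambda>n. u (r n) x) \<longlonglongrightarrow> g x"
proof -
  have "\<exists>r::nat\<Rightarrow>nat. strict_mono r \<and> (AE x in M. (\<lambda>n. (norm (u (r n) x - g x))\<^sup>2) \<longlonglongrightarrow> 0)"
    using lim by (intro tendsto_L1_AE_subseq) (simp_all add: L2_integrable_norm2[OF L2_diff[OF u g]])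
  then obtain r :: "nat \<Rightarrow> nat" where r: "strict_mono r"
    and ae: "AE x in M. (\<lambda>n. (norm (u (r n) x - g x))\<^sup>2) \<longlonglongrightarrow> 0"
    by auto
  from ae have "AE x in M. (\<lambda>n. u (r n) x) \<longlonglongrightarrow> g x"
    by eventually_elim (drule tendsto_real_sqrt, simp add: tendsto_norm_zero_iff LIM_zero_iff)
  with r show ?thesis
    by (rule that)
qed

text \<open>Closed intervals generate the Borel sets, so vanishing integrals extend from intervals
  to all Borel sets by induction; a function whose integral over every Borel set is 0 vanishes
  almost everywhere.\<close>

lemma AE_eq_0_if_interval_integrals_eq_0:
  fixes u :: "real \<Rightarrow> 'b::euclidean_space"
  assumes int: "\<And>a b. integrable lborel (\<lambda>x. indicator {a..b} x *\<^sub>R u x)"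
    and zero: "\<And>a b. (LINT x|lborel. indicator {a..b} x *\<^sub>R u x) = 0"
  shows "AE x in lborel. u x = 0"
proof -
  have "AE x in lborel. indicator {- real n..real n} x *\<^sub>R u x = 0" for n
  proof -
    \<comment> \<open>The function \<open>u\<close> is only locally integrable; cutting it off makes
      integrals over complements and countable unions meaningful.\<close>
    define v where "v x = indicator {- real n..real n} x *\<^sub>R u x" for x
    have v: "integrable lborel v" "(LINT x|lborel. v x) = 0"
      unfolding v_def by (rule int zero)+
    have set_int: "set_integrable lborel A v" if "A \<in> sets borel" for A
      using that v(1) unfolding set_integrable_def by (intro integrable_mult_indicator) simp_all
    have A: "(LINT x:A|lborel. v x) = 0" if "A \<in> sets borel" for A
      using that
    proof (induction rule: borel_set_induct)
      case empty
      then show ?case by (simp add: set_lebesgue_integral_def)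
    next
      case (interval a b)
      \<comment> \<open>An intersection of two intervals is an interval or empty, and
        \<open>zero\<close> covers the empty case, where the left endpoint exceeds the right
        one.\<close>
      have "indicator {a..b} x *\<^sub>R v x = indicator {max a (- real n)..min b (real n)} x *\<^sub>R u x" for x
        by (auto simp: v_def indicator_def)
      then show ?case
        by (simp add: set_lebesgue_integral_def zero)
    next
      case (compl A)
      have "(LINT x:A \<union> - A|lborel. v x) = (LINT x:A|lborel. v x) + (LINT x:- A|lborel. v x)"
        by (intro set_integral_Un set_int) (use compl in auto)
      with compl v(2) show ?case
        by (simp add: set_lebesgue_integral_def)
    next
      case (union f)
      then have "(LINT x:(\<Union>i. f i)|lborel. v x) = (\<Sum>i. (LINT x:f i|lborel. v x))"
        by (intro lebesgue_integral_countable_add set_int sets.countable_UN)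
          (auto simp: disjoint_family_on_def)
      with union show ?case by simp
    qed
    \<comment> \<open>Uniqueness of densities is applied to real functions, hence to one coordinate
      at a time.\<close>
    have "AE x in lborel. v x \<bullet> b = 0" for b
    proof (rule density_unique_real)
      show "integrable lborel (\<lambda>x. v x \<bullet> b)" "integrable lborel (\<lambda>x::real. 0 :: real)"
        using v by simp_all
      fix A :: "real set" assume "A \<in> sets lborel"
      then have "A \<in> sets borel" by simp
      from A[OF this] set_int[OF this] have "(LINT x|lborel. (indicator A x *\<^sub>R v x) \<bullet> b) = 0"
        unfolding set_lebesgue_integral_def set_integrable_def
        by (subst integral_inner_left) simp_all
      then show "(LINT x:A|lborel. v x \<bullet> b) = (LINT x:A|lborel. 0)"
        by (simp add: set_lebesgue_integral_def)
    qed
    then have "AE x in lborel. \<forall>b\<in>Basis. v x \<bullet> b = 0"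
      by (intro AE_finite_allI) simp_all
    then show ?thesis
      by eventually_elim (simp add: euclidean_all_zero_iff v_def)
  qed
  then have "AE x in lborel. \<forall>n. indicator {- real n..real n} x *\<^sub>R u x = 0"
    by (subst AE_all_countable) blast
  then show ?thesis
  proof eventually_elim
    fix x assume *: "\<forall>n. indicator {- real n..real n} x *\<^sub>R u x = 0"
    obtain n where "\<bar>x\<bar> \<le> real n"
      using real_arch_simple by blast
    with *[rule_format, of n] show "u x = 0"
      by (simp add: indicator_def split: if_splits)
  qed
qed

section \<open>The transform as a Gaussian-windowed Fourier integral\<close>

lemma lborel_Fubini:
  fixes \<Phi> :: "'a::euclidean_space \<Rightarrow> 'b::euclidean_space \<Rightarrow> 'c::{banach, second_countable_topology}"
  assumes meas: "(\<lambda>(x, y). \<Phi> x y) \<in> borel_measurable (lborel \<Otimes>\<^sub>M lborel)"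
    and int1: "\<And>y. integrable lborel (\<lambda>x. \<Phi> x y)"
    and int2: "integrable lborel (\<lambda>y. LINT x|lborel. norm (\<Phi> x y))"
  shows "integrable (lborel \<Otimes>\<^sub>M lborel) (\<lambda>(x, y). \<Phi> x y)"
    and "integrable lborel (\<lambda>x. LINT y|lborel. \<Phi> x y)"
    and "integrable lborel (\<lambda>y. LINT x|lborel. \<Phi> x y)"
    and "(LINT x|lborel. LINT y|lborel. \<Phi> x y) = (LINT y|lborel. LINT x|lborel. \<Phi> x y)"
proof -
  note [measurable] = meas
  have "(\<lambda>(y, x). \<Phi> x y) \<in> borel_measurable (lborel \<Otimes>\<^sub>M lborel)"
    by measurable
  then have "integrable (lborel \<Otimes>\<^sub>M lborel) (\<lambda>(y, x). \<Phi> x y)"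
    using int1 int2 by (intro lborel_pair.Fubini_integrable) auto
  from lborel_pair.integrable_product_swap[OF this]
  show int: "integrable (lborel \<Otimes>\<^sub>M lborel) (\<lambda>(x, y). \<Phi> x y)"
    by (simp add: case_prod_beta)
  show "integrable lborel (\<lambda>x. LINT y|lborel. \<Phi> x y)"
    using lborel_pair.integrable_fst'[OF int] by simp
  show "integrable lborel (\<lambda>y. LINT x|lborel. \<Phi> x y)"
    using lborel_pair.integrable_snd[OF int] by simp
  show "(LINT x|lborel. LINT y|lborel. \<Phi> x y) = (LINT y|lborel. LINT x|lborel. \<Phi> x y)"
    by (rule lborel_pair.Fubini_integral[OF int, symmetric])
qed

text \<open>Stated for algebras without commutativity, with the order of the factors preserved, so
  that it applies to quaternion-valued functions.\<close>

lemma lborel_prod_mult: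
  fixes u :: "'a::euclidean_space \<Rightarrow> 'c::{banach, second_countable_topology, real_normed_algebra}"
    and v :: "'b::euclidean_space \<Rightarrow> 'c"
  assumes u: "integrable lborel u" and v: "integrable lborel v"
  shows "integrable lborel (\<lambda>p. u (fst p) * v (snd p))"
    and "(LINT p|lborel. u (fst p) * v (snd p)) = (LINT x|lborel. u x) * (LINT y|lborel. v y)"
proof -
  have [measurable]: "u \<in> borel_measurable borel" "v \<in> borel_measurable borel"
    using borel_measurable_integrable[OF u] borel_measurable_integrable[OF v] by simp_all
  have "(\<integral>\<^sup>+p. ennreal (norm (u (fst p) * v (snd p))) \<partial>(lborel \<Otimes>\<^sub>M lborel))
      \<le> (\<integral>\<^sup>+p. ennreal (norm (u (fst p))) * ennreal (norm (v (snd p))) \<partial>(lborel \<Otimes>\<^sub>M lborel))"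
    by (intro nn_integral_mono) (simp add: ennreal_mult[symmetric] norm_mult_ineq ennreal_leI)
  also have "\<dots> = (\<integral>\<^sup>+x. ennreal (norm (u x)) * (\<integral>\<^sup>+y. ennreal (norm (v y)) \<partial>lborel) \<partial>lborel)"
    by (subst lborel.nn_integral_fst[symmetric]) (simp_all add: nn_integral_cmult)
  also have "\<dots> = (\<integral>\<^sup>+x. ennreal (norm (u x)) \<partial>lborel) * (\<integral>\<^sup>+y. ennreal (norm (v y)) \<partial>lborel)"
    by (rule nn_integral_multc) simp
  also have "\<dots> < \<infinity>"
    using u v by (simp add: integrable_iff_bounded ennreal_mult_less_top)
  finally have int: "integrable (lborel \<Otimes>\<^sub>M lborel) (\<lambda>p. u (fst p) * v (snd p))"
    by (intro integrableI_bounded) simp_all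
  then show "integrable lborel (\<lambda>p. u (fst p) * v (snd p))"
    by (simp add: lborel_prod)
  have "(LINT p|lborel. u (fst p) * v (snd p)) = integral\<^sup>L (lborel \<Otimes>\<^sub>M lborel) (\<lambda>p. u (fst p) * v (snd p))"
    by (simp add: lborel_prod)
  also have "\<dots> = (LINT x|lborel. LINT y|lborel. u x * v y)"
    using lborel_pair.integral_fst'[OF int] by simp
  also have "\<dots> = (LINT x|lborel. u x) * (LINT y|lborel. v y)"
    using u v by simp
  finally show "(LINT p|lborel. u (fst p) * v (snd p)) = (LINT x|lborel. u x) * (LINT y|lborel. v y)" .
qed

lemma borel_measurable_fst_borel [measurable]:
  "fst \<in> borel_measurable (borel :: ('a::second_countable_topology \<times> 'b::second_countable_topology) measure)"
  unfolding borel_prod[symmetric] by simp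

lemma borel_measurable_snd_borel [measurable]:
  "snd \<in> borel_measurable (borel :: ('a::second_countable_topology \<times> 'b::second_countable_topology) measure)"
  unfolding borel_prod[symmetric] by simp

text \<open>Follows from \<open>norm_le_1_plus_norm2\<close> and the bound 1 on the Gaussian. The
  estimate is uniform in \<open>x\<close>, which gives the dominating constant when integrals over
  the plane and the line are interchanged.\<close>

lemma gauss_L2_integrable:
  assumes f: "f \<in> L2 lborel"
  shows "integrable lborel (\<lambda>t. gauss (t - x) * norm (f t))"
    and "(LINT t|lborel. gauss (t - x) * norm (f t)) \<le> 1 + (LINT t|lborel. (norm (f t))\<^sup>2)"
proof -
  have [measurable]: "f \<in> borel_measurable borel"
    using L2_measurable[OF f] by simp
  have g: "integrable lborel (\<lambda>t. gauss (t - x))" "(LINT t|lborel. gauss (t - x)) = 1"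
    using integrable_gauss[of 1 "- x"] integral_gauss[of 1 "- x"] by simp_all
  have int: "integrable lborel (\<lambda>t. gauss (t - x) + (norm (f t))\<^sup>2)"
    by (intro Bochner_Integration.integrable_add g L2_integrable_norm2 f)
  have le: "gauss (t - x) * norm (f t) \<le> gauss (t - x) + (norm (f t))\<^sup>2" for t
  proof -
    have "norm (f t) \<le> 1 + (norm (f t))\<^sup>2"
      by (rule norm_le_1_plus_norm2)
    then have "gauss (t - x) * norm (f t) \<le> gauss (t - x) * (1 + (norm (f t))\<^sup>2)"
      by (rule mult_left_mono) simp
    also have "\<dots> \<le> gauss (t - x) + 1 * (norm (f t))\<^sup>2"
      unfolding distrib_left by (intro add_mono mult_right_mono) simp_all
    finally show ?thesis by simp
  qed
  show *: "integrable lborel (\<lambda>t. gauss (t - x) * norm (f t))"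
    by (rule Bochner_Integration.integrable_bound[OF int]) (auto simp: le)
  have "(LINT t|lborel. gauss (t - x) * norm (f t)) \<le> (LINT t|lborel. gauss (t - x) + (norm (f t))\<^sup>2)"
    by (intro integral_mono * int le)
  also have "\<dots> = 1 + (LINT t|lborel. (norm (f t))\<^sup>2)"
    using g L2_integrable_norm2[OF f] by simp
  finally show "(LINT t|lborel. gauss (t - x) * norm (f t)) \<le> 1 + (LINT t|lborel. (norm (f t))\<^sup>2)" .
qed

text \<open>The window \<open>2^(1/4) * gauss t\<close> has norm 1 in the space of square integrable
  functions. The prefactor \<open>2^(3/4)\<close> is \<open>sqrt 2\<close> times that of the window,
  and this is the origin of the 2 in the inversion formula.\<close>

definition stft :: "quat \<Rightarrow> (real \<Rightarrow> quat) \<Rightarrow> real \<times> real \<Rightarrow> quat" where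
  "stft I f p = (2 powr (3/4)) *\<^sub>R
     (LINT t|lborel. gauss (t - fst p) *\<^sub>R (qexp I (- (2 * pi * t * snd p)) * f t))"

lemma stft_integrable:
  assumes I: "I \<in> quat_sphere" and f: "f \<in> L2 lborel"
  shows "integrable lborel (\<lambda>t. gauss (t - x) *\<^sub>R (qexp I (- (2 * pi * t * w)) * f t))"
proof -
  have [measurable]: "f \<in> borel_measurable borel"
    using L2_measurable[OF f] by simp
  show ?thesis
    by (rule Bochner_Integration.integrable_bound[OF gauss_L2_integrable(1)[OF f, of x]])
      (simp_all add: norm_quat_mult I)
qed

text \<open>All exponentials in the definition lie in the commutative slice of \<open>I\<close>, so
  their product can be computed with complex exponents.\<close>

lemma qstft_eq_stft:
  assumes I: "I \<in> quat_sphere" and f: "f \<in> L2 lborel"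
  shows "qstft I f = stft I f"
proof
  fix p :: "real \<times> real"
  obtain x w where p: "p = (x, w)" by fastforce
  define q where "q = qcnj (of_real x + w *\<^sub>R I) /\<^sub>R sqrt 2"
  have q: "q = quat_of_complex I (Complex x (- w) / sqrt 2)"
  proof -
    have "of_real x + w *\<^sub>R I = quat_of_complex I (Complex x w)"
      by (simp add: quat_of_complex_def)
    then have "q = quat_of_complex I (Complex x (- w) /\<^sub>R sqrt 2)"
      by (simp add: q_def qcnj_quat_of_complex[OF I] quat_of_complex_scaleR complex_cnj)
    then show ?thesis
      by (simp add: scaleR_conv_of_real divide_inverse mult.commute)
  qed
  have n: "(norm (of_real x + w *\<^sub>R I))\<^sup>2 = x\<^sup>2 + w\<^sup>2"
    using norm_quat_of_complex[OF I, of "Complex x w"] by (simp add: quat_of_complex_def cmod_power2)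
  have kernel: "exp (- ((pi * x * w) *\<^sub>R I)) *
      exp (- (pi *\<^sub>R (q\<^sup>2 + of_real (t\<^sup>2))) + (2 * pi * sqrt 2 * t) *\<^sub>R q) *
      of_real (exp (- (pi * (x\<^sup>2 + w\<^sup>2) / 2))) = gauss (t - x) *\<^sub>R qexp I (- (2 * pi * t * w))" for t
  proof -
    let ?z = "Complex x (- w) / sqrt 2"
    have 1: "exp (- ((pi * x * w) *\<^sub>R I)) = quat_of_complex I (exp (- (\<i> * (pi * x * w))))"
      by (simp add: quat_of_complex_exp[OF I]) (simp add: quat_of_complex_def)
    have 2: "- (pi *\<^sub>R (q\<^sup>2 + of_real (t\<^sup>2))) + (2 * pi * sqrt 2 * t) *\<^sub>R q
        = quat_of_complex I (- (pi *\<^sub>R (?z\<^sup>2 + of_real (t\<^sup>2))) + (2 * pi * sqrt 2 * t) *\<^sub>R ?z)"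
      unfolding q
      by (simp only: quat_of_complex_power[OF I, symmetric] quat_of_complex_of_real[of I, symmetric] quat_of_complex_add[symmetric]
          quat_of_complex_scaleR[symmetric] linear_neg[OF bounded_linear.linear[OF bounded_linear_quat_of_complex], symmetric])
    \<comment> \<open>The square of \<open>?z\<close> contributes a phase in \<open>x * w\<close>
      that cancels the first factor, and a term in \<open>w^2\<close> that cancels the one from the
      norm of \<open>q\<close>; the rest is a perfect square and a linear phase.\<close>
    have "- (\<i> * (pi * x * w)) + (- (pi *\<^sub>R (?z\<^sup>2 + of_real (t\<^sup>2))) + (2 * pi * sqrt 2 * t) *\<^sub>R ?z)
        + of_real (- (pi * (x\<^sup>2 + w\<^sup>2) / 2)) = of_real (- (pi * (t - x)\<^sup>2)) + \<i> * of_real (- (2 * pi * t * w))"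
      by (simp add: complex_eq_iff power2_eq_square field_simps)
    then have "exp (- (\<i> * (pi * x * w))) * exp (- (pi *\<^sub>R (?z\<^sup>2 + of_real (t\<^sup>2))) + (2 * pi * sqrt 2 * t) *\<^sub>R ?z)
        * of_real (exp (- (pi * (x\<^sup>2 + w\<^sup>2) / 2))) = gauss (t - x) *\<^sub>R cis (- (2 * pi * t * w))"
      unfolding exp_of_real[symmetric] exp_add[symmetric]
      by (simp only: exp_add) (simp only: gauss_def cis_conv_exp scaleR_conv_of_real exp_of_real)
    then have "quat_of_complex I (exp (- (\<i> * (pi * x * w))) * exp (- (pi *\<^sub>R (?z\<^sup>2 + of_real (t\<^sup>2))) + (2 * pi * sqrt 2 * t) *\<^sub>R ?z)
        * of_real (exp (- (pi * (x\<^sup>2 + w\<^sup>2) / 2)))) = quat_of_complex I (gauss (t - x) *\<^sub>R cis (- (2 * pi * t * w)))"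
      by simp
    then show ?thesis
      unfolding 1 2 by (simp only: quat_of_complex_mult[OF I] quat_of_complex_exp[OF I] quat_of_complex_of_real quat_of_complex_scaleR qexp_quat_of_complex[OF I])
  qed
  define E where "E t = exp (- (pi *\<^sub>R (q\<^sup>2 + of_real (t\<^sup>2))) + (2 * pi * sqrt 2 * t) *\<^sub>R q)" for t
  define A where "A = exp (- ((pi * x * w) *\<^sub>R I))"
  define c where "c = exp (- (pi * (x\<^sup>2 + w\<^sup>2) / 2))"
  have c: "c \<noteq> 0"
    by (simp add: c_def)
  have kernel': "c *\<^sub>R (A * E t) = gauss (t - x) *\<^sub>R qexp I (- (2 * pi * t * w))" for t
    using kernel[of t] by (simp add: A_def E_def c_def of_real_def)
  have A_inv: "exp ((pi * x * w) *\<^sub>R I) * A = 1"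
    by (simp add: A_def exp_minus_inverse)
  \<comment> \<open>Solving for \<open>E\<close> derives the integrability of the Segal-Bargmann
    integrand from \<open>stft_integrable\<close>. It is required for moving the left factor
    \<open>A\<close> under the integral.\<close>
  have E_eq: "E t = (1 / c) *\<^sub>R (exp ((pi * x * w) *\<^sub>R I) * (gauss (t - x) *\<^sub>R qexp I (- (2 * pi * t * w))))" for t
  proof -
    have "exp ((pi * x * w) *\<^sub>R I) * (c *\<^sub>R (A * E t)) = c *\<^sub>R E t"
      using A_inv by (simp add: mult.assoc[symmetric])
    then show ?thesis
      using c unfolding kernel'[symmetric] by simp
  qed
  have int: "integrable lborel (\<lambda>t. (2 powr (3/4)) *\<^sub>R E t * f t)"
  proof -
    have "integrable lborel (\<lambda>t. (2 powr (3/4) / c) *\<^sub>R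
        (exp ((pi * x * w) *\<^sub>R I) * (gauss (t - x) *\<^sub>R (qexp I (- (2 * pi * t * w)) * f t))))"
      by (intro integrable_scaleR_right integrable_mult_right stft_integrable[OF I f])
    then show ?thesis
      by (simp add: E_eq mult.assoc)
  qed
  have "qstft I f p = c *\<^sub>R (A * (LINT t|lborel. (2 powr (3/4)) *\<^sub>R E t * f t))"
    unfolding qstft_def p prod.case Let_def segal_bargmann_def q_def[symmetric] n A_def[symmetric]
      c_def[symmetric] E_def[symmetric] by (simp add: of_real_def)
  also have "\<dots> = (LINT t|lborel. c *\<^sub>R (A * ((2 powr (3/4)) *\<^sub>R E t * f t)))"
    unfolding integral_scaleR_right by (intro arg_cong[where f = "\<lambda>q. c *\<^sub>R q"] Bochner_Integration.integral_mult_right[symmetric] int)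
  also have "\<dots> = (LINT t|lborel. (2 powr (3/4)) *\<^sub>R ((c *\<^sub>R (A * E t)) * f t))"
    by (intro Bochner_Integration.integral_cong refl) (simp add: mult.assoc mult.left_commute)
  finally show "qstft I f p = stft I f p"
    unfolding kernel' integral_scaleR_right by (simp add: stft_def p)
qed

lemma stft_measurable:
  assumes "f \<in> L2 lborel"
  shows "stft I f \<in> borel_measurable borel"
proof -
  have [measurable]: "f \<in> borel_measurable borel"
    using L2_measurable[OF assms] by simp
  have "(\<lambda>(p, t). gauss (t - fst p) *\<^sub>R (qexp I (- (2 * pi * t * snd p)) * f t)) \<in> borel_measurable (borel \<Otimes>\<^sub>M lborel)"
    by measurable
  then show ?thesis
    unfolding stft_def[abs_def] by measurable
qed

section \<open>Plancherel bound and weak inversion\<close>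

text \<open>In either variable alone the kernel is nonnegative with integral 1, so spreading
  \<open>q\<close> over the plane preserves its integral.\<close>

lemma gauss_conv_integrable:
  fixes q :: "real \<Rightarrow> real"
  assumes q: "integrable lborel q" and e: "e > 0"
  shows "integrable lborel (\<lambda>z. gauss ((fst z - snd z) / e) / e * q (fst z))"
    and "integrable lborel (\<lambda>z. gauss ((fst z - snd z) / e) / e * q (snd z))"
    and "(LINT z|lborel. gauss ((fst z - snd z) / e) / e * q (fst z)) = integral\<^sup>L lborel q"
    and "(LINT z|lborel. gauss ((fst z - snd z) / e) / e * q (snd z)) = integral\<^sup>L lborel q"
proof -
  have [measurable]: "q \<in> borel_measurable borel"
    using borel_measurable_integrable[OF q] by simp
  have g: "integrable lborel (\<lambda>s. gauss ((s - t) / e))" "(LINT s|lborel. gauss ((s - t) / e)) = e" for t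
    using integrable_gauss[of "1 / e" "- t / e"] integral_gauss[of "1 / e" "- t / e"] e
    by (simp_all add: diff_divide_distrib)
  have sym: "gauss ((s - t) / e) = gauss ((t - s) / e)" for s t
    by (metis gauss_minus minus_diff_eq minus_divide_left)
  have 1: "integrable (lborel \<Otimes>\<^sub>M lborel) (\<lambda>(s, t). gauss ((s - t) / e) / e * q t)"
    using q g e by (intro lborel_Fubini(1)) (simp_all add: abs_mult)
  then show int2: "integrable lborel (\<lambda>z. gauss ((fst z - snd z) / e) / e * q (snd z))"
    by (simp add: lborel_prod case_prod_beta')
  have 2: "integrable (lborel \<Otimes>\<^sub>M lborel) (\<lambda>(s, t). gauss ((s - t) / e) / e * q s)"
    using lborel_pair.integrable_product_swap[OF 1] by (simp add: case_prod_beta' sym[of "fst _"])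
  then show int1: "integrable lborel (\<lambda>z. gauss ((fst z - snd z) / e) / e * q (fst z))"
    by (simp add: lborel_prod case_prod_beta')
  have "e * integral\<^sup>L lborel q = (LINT z|lborel. gauss ((fst z - snd z) / e) * q (fst z))"
    using lborel_pair.integral_fst'[OF 2] e g by (simp add: sym lborel_prod case_prod_beta')
  from this[symmetric] show "(LINT z|lborel. gauss ((fst z - snd z) / e) / e * q (fst z)) = integral\<^sup>L lborel q"
    using e by simp
  show "(LINT z|lborel. gauss ((fst z - snd z) / e) / e * q (snd z)) = integral\<^sup>L lborel q"
    using lborel_pair.integral_snd[OF 1] e g by (simp add: lborel_prod case_prod_beta')
qed

text \<open>The inequality of arithmetic and geometric means separates \<open>h\<close> from
  \<open>f\<close>, after which each square is integrated against the kernel. The bound does not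
  depend on \<open>e\<close>.\<close>

lemma gauss_kernel_integrable:
  assumes h: "h \<in> L2 lborel" and f: "f \<in> L2 lborel" and e: "e > 0"
  shows "integrable lborel (\<lambda>z. gauss ((fst z - snd z) / e) / e * (norm (h (fst z)) * norm (f (snd z))))" (is "integrable _ ?g")
    and "(LINT z|lborel. gauss ((fst z - snd z) / e) / e * (norm (h (fst z)) * norm (f (snd z))))
      \<le> ((LINT s|lborel. (norm (h s))\<^sup>2) + (LINT s|lborel. (norm (f s))\<^sup>2)) / 2"
proof -
  have [measurable]: "h \<in> borel_measurable borel" "f \<in> borel_measurable borel"
    using L2_measurable h f by fastforce+
  let ?b = "\<lambda>z. (gauss ((fst z - snd z) / e) / e * (norm (h (fst z)))\<^sup>2
      + gauss ((fst z - snd z) / e) / e * (norm (f (snd z)))\<^sup>2) / 2"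
  have b: "integrable lborel ?b" "integral\<^sup>L lborel ?b
      = ((LINT s|lborel. (norm (h s))\<^sup>2) + (LINT s|lborel. (norm (f s))\<^sup>2)) / 2"
    using gauss_conv_integrable[OF L2_integrable_norm2[OF h] e]
      gauss_conv_integrable[OF L2_integrable_norm2[OF f] e] by simp_all
  have le: "?g z \<le> ?b z" for z
  proof -
    have "norm (h (fst z)) * norm (f (snd z)) \<le> ((norm (h (fst z)))\<^sup>2 + (norm (f (snd z)))\<^sup>2) / 2"
      using sum_squares_bound[of "norm (h (fst z))" "norm (f (snd z))"] by simp
    then have "?g z \<le> gauss ((fst z - snd z) / e) / e * (((norm (h (fst z)))\<^sup>2 + (norm (f (snd z)))\<^sup>2) / 2)"
      using e by (intro mult_left_mono) simp_all
    also have "\<dots> = ?b z"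
      by (simp only: distrib_left times_divide_eq_right)
    finally show ?thesis .
  qed
  show g: "integrable lborel ?g"
    by (rule Bochner_Integration.integrable_bound[OF b(1)]) (use le e in \<open>auto intro!: AE_I2 order_trans[OF le]\<close>)
  from integral_mono[OF g b(1) le] show "integral\<^sup>L lborel ?g
      \<le> ((LINT s|lborel. (norm (h s))\<^sup>2) + (LINT s|lborel. (norm (f s))\<^sup>2)) / 2"
    unfolding b(2) .
qed

text \<open>The factor \<open>gauss (e * snd p)\<close> makes the integral over the plane absolutely convergent jointly in
  all four variables, so that the frequency can be integrated out first.\<close>

lemma stft_regularised:
  fixes h f :: "real \<Rightarrow> quat"
  defines "R e z \<equiv> (2 * (gauss ((fst z - snd z) / e) / e * gauss ((fst z - snd z) / sqrt 2)))
      *\<^sub>R (qcnj (h (fst z)) * f (snd z))"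
  assumes I: "I \<in> quat_sphere" and h: "h \<in> L2 lborel" and f: "f \<in> L2 lborel" and e: "e > 0"
  shows "integrable lborel (\<lambda>p. gauss (e * snd p) *\<^sub>R (qcnj (stft I h p) * stft I f p))"
    and "integrable lborel (R e)"
    and "(LINT p|lborel. gauss (e * snd p) *\<^sub>R (qcnj (stft I h p) * stft I f p)) = integral\<^sup>L lborel (R e)"
proof -
  have [measurable]: "h \<in> borel_measurable borel" "f \<in> borel_measurable borel"
    using L2_measurable h f by fastforce+
  \<comment> \<open>The integrand of the product of the two transforms, expanded over the pair
    \<open>z\<close> of time variables; \<open>2^(3/2)\<close> is the product of the two
    prefactors.\<close>
  define \<Phi> where "\<Phi> p z = (2 powr (3/2) * (gauss (e * snd p) * (gauss (fst z - fst p) * gauss (snd z - fst p))))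
      *\<^sub>R (qcnj (h (fst z)) * (qexp I (2 * pi * (fst z - snd z) * snd p) * f (snd z)))"
    for p z :: "real \<times> real"
  have meas: "(\<lambda>(p, z). \<Phi> p z) \<in> borel_measurable (lborel \<Otimes>\<^sub>M lborel)"
    unfolding \<Phi>_def by measurable
  have in_z: "(LINT z|lborel. \<Phi> p z) = gauss (e * snd p) *\<^sub>R (qcnj (stft I h p) * stft I f p)" for p
  proof -
    let ?H = "\<lambda>s. gauss (s - fst p) *\<^sub>R (qexp I (- (2 * pi * s * snd p)) * h s)"
    let ?F = "\<lambda>t. gauss (t - fst p) *\<^sub>R (qexp I (- (2 * pi * t * snd p)) * f t)"
    note intH = stft_integrable[OF I h, of "fst p" "snd p"]
    note intF = stft_integrable[OF I f, of "fst p" "snd p"]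
    have "\<Phi> p z = (2 powr (3/2) * gauss (e * snd p)) *\<^sub>R (qcnj (?H (fst z)) * ?F (snd z))" for z
    proof -
      \<comment> \<open>Splitting the phase gives one factor to each time variable; conjugation
        reverses both the sign of the phase and the order of the product with
        \<open>h\<close>.\<close>
      have "qexp I (2 * pi * (fst z - snd z) * snd p) = qexp I (2 * pi * fst z * snd p) * qexp I (- (2 * pi * snd z * snd p))"
        by (simp add: qexp_add[OF I, symmetric] algebra_simps)
      then show ?thesis
        by (simp add: \<Phi>_def qcnj_scaleR qcnj_mult qcnj_qexp[OF I] mult.assoc mult_ac)
    qed
    then have "(LINT z|lborel. \<Phi> p z) = (2 powr (3/2) * gauss (e * snd p)) *\<^sub>R
        ((LINT s|lborel. qcnj (?H s)) * (LINT t|lborel. ?F t))"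
      unfolding lborel_prod_mult(2)[OF integrable_bounded_linear[OF bounded_linear_qcnj intH] intF, symmetric]
      by (simp only: integral_scaleR_right)
    also have "(LINT s|lborel. qcnj (?H s)) = qcnj (LINT s|lborel. ?H s)"
      by (rule integral_bounded_linear[OF bounded_linear_qcnj intH])
    also have "(2 powr (3/2) * gauss (e * snd p)) *\<^sub>R (qcnj (LINT s|lborel. ?H s) * (LINT t|lborel. ?F t))
        = gauss (e * snd p) *\<^sub>R (qcnj (stft I h p) * stft I f p)"
      by (simp add: stft_def qcnj_scaleR powr_add[symmetric])
    finally show ?thesis .
  qed
  have in_p: "integrable lborel (\<lambda>p. \<Phi> p z)" "(LINT p|lborel. \<Phi> p z) = R e z" for z
  proof -
    let ?u = "\<lambda>x. of_real (gauss (fst z - x) * gauss (snd z - x)) :: quat"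
    let ?v = "\<lambda>w. gauss (e * w) *\<^sub>R qexp I (2 * pi * (fst z - snd z) * w)"
    have \<Phi>: "\<Phi> p z = (2 powr (3/2)) *\<^sub>R (qcnj (h (fst z)) * (?u (fst p) * ?v (snd p)) * f (snd z))" for p
      by (simp add: \<Phi>_def of_real_def mult.assoc mult_ac)
    have "has_bochner_integral lborel (\<lambda>x. gauss (fst z - x) * gauss (snd z - x)) (gauss ((fst z - snd z) / sqrt 2) * (1 / \<bar>sqrt 2\<bar>))"
      unfolding gauss_mult_gauss by (intro has_bochner_integral_mult_right has_bochner_integral_gauss) simp
    then have u: "integrable lborel ?u" "integral\<^sup>L lborel ?u = of_real (gauss ((fst z - snd z) / sqrt 2) / sqrt 2)"
      unfolding of_real_def by (simp_all add: has_bochner_integral_iff)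
    have v: "integrable lborel ?v" "integral\<^sup>L lborel ?v = of_real (gauss ((fst z - snd z) / e) / e)"
      using has_bochner_integral_qexp_gauss[OF I e, of "fst z - snd z"] by (simp_all add: has_bochner_integral_iff)
    note uv = lborel_prod_mult[OF u(1) v(1)]
    have "has_bochner_integral lborel (\<lambda>p. \<Phi> p z) ((2 powr (3/2)) *\<^sub>R (qcnj (h (fst z)) *
        (of_real (gauss ((fst z - snd z) / sqrt 2) / sqrt 2) * of_real (gauss ((fst z - snd z) / e) / e)) * f (snd z)))"
      unfolding \<Phi>
      by (intro has_bochner_integral_scaleR_right has_bochner_integral_mult_left has_bochner_integral_mult_right)
        (simp only: has_bochner_integral_iff uv u v simp_thms)
    \<comment> \<open>The factor \<open>sqrt 2\<close> is cancelled by the integral of the Gaussian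
      in \<open>x\<close>, leaving the constant 2 of the theorem.\<close>
    moreover have "2 powr (3/2) = 2 * sqrt 2"
      using powr_add[of "2::real" 1 "1/2"] by (simp add: powr_half_sqrt)
    ultimately show "integrable lborel (\<lambda>p. \<Phi> p z)" "(LINT p|lborel. \<Phi> p z) = R e z"
      by (simp_all add: has_bochner_integral_iff R_def of_real_def)
  qed
  have "integrable lborel (\<lambda>z. LINT p|lborel. norm (\<Phi> p z))"
  proof -
    \<comment> \<open>In the norm the phase disappears, so the frequency integral is only
      \<open>1 / e\<close>. The integral over \<open>x\<close> leaves a Gaussian of width
      \<open>sqrt 2\<close> in the time difference, and \<open>gauss_kernel_integrable\<close>
      applies with that width.\<close>
    have "(LINT p|lborel. norm (\<Phi> p z))
        = 2 powr (3/2) / e * (gauss ((fst z - snd z) / sqrt 2) / sqrt 2 * (norm (h (fst z)) * norm (f (snd z))))" for z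
    proof -
      let ?u = "\<lambda>x. gauss (fst z - x) * gauss (snd z - x)" and ?v = "\<lambda>w. gauss (e * w)"
      have u: "has_bochner_integral lborel ?u (gauss ((fst z - snd z) / sqrt 2) * (1 / \<bar>sqrt 2\<bar>))"
        unfolding gauss_mult_gauss by (intro has_bochner_integral_mult_right has_bochner_integral_gauss) simp
      have v: "has_bochner_integral lborel ?v (1 / e)"
        using has_bochner_integral_gauss[of e 0] e by simp
      have "(LINT p|lborel. norm (\<Phi> p z)) = (LINT p|lborel. (2 powr (3/2) * (norm (h (fst z)) * norm (f (snd z)))) * (?u (fst p) * ?v (snd p)))"
        by (intro Bochner_Integration.integral_cong refl) (simp add: \<Phi>_def norm_quat_mult I abs_mult)
      also have "\<dots> = (2 powr (3/2) * (norm (h (fst z)) * norm (f (snd z)))) * (integral\<^sup>L lborel ?u * integral\<^sup>L lborel ?v)"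
        using lborel_prod_mult(2)[of ?u ?v] u v by (simp add: has_bochner_integral_iff)
      finally show ?thesis
        using u v by (simp add: has_bochner_integral_iff mult_ac)
    qed
    note * = this
    show ?thesis
      unfolding * by (intro Bochner_Integration.integrable_mult_right gauss_kernel_integrable(1) h f) simp
  qed
  note F = lborel_Fubini[OF meas in_p(1) this, unfolded in_z in_p(2)]
  show "integrable lborel (\<lambda>p. gauss (e * snd p) *\<^sub>R (qcnj (stft I h p) * stft I f p))"
    by (rule F(2))
  show "integrable lborel (R e)"
    by (rule F(3))
  show "(LINT p|lborel. gauss (e * snd p) *\<^sub>R (qcnj (stft I h p) * stft I f p)) = integral\<^sup>L lborel (R e)"
    by (rule F(4))
qed

lemma tendsto_gauss_1:
  assumes "\<delta> \<longlonglongrightarrow> 0"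
  shows "(\<lambda>n. gauss (\<delta> n)) \<longlonglongrightarrow> 1"
  using isCont_tendsto_compose[OF continuous_gauss assms] by simp

lemma inverse_Suc_mult_tendsto_0: "(\<lambda>n. 1 / real (Suc n) * c) \<longlonglongrightarrow> 0"
  using tendsto_mult_left_zero[OF LIMSEQ_inverse_real_of_nat] by (simp only: inverse_eq_divide)

text \<open>For \<open>h = f\<close> the regularised identity expresses a weighted energy of the
  transform. Bounding the fixed Gaussian factor by 1 leaves the kernel estimate, uniform in the
  regularisation, and Fatou's lemma removes the weight.\<close>

lemma stft_bound:
  assumes I: "I \<in> quat_sphere" and f: "f \<in> L2 lborel"
  shows "stft I f \<in> L2 lborel"
    and "(LINT p|lborel. (norm (stft I f p))\<^sup>2) \<le> 2 * (LINT t|lborel. (norm (f t))\<^sup>2)"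
proof -
  have [measurable]: "stft I f \<in> borel_measurable borel"
    by (rule stft_measurable[OF f])
  define A where "A = (LINT t|lborel. (norm (f t))\<^sup>2)"
  have A: "0 \<le> A"
    by (simp add: A_def)
  define u where "u n p = gauss (1 / real (Suc n) * snd p) * (norm (stft I f p))\<^sup>2" for n and p :: "real \<times> real"
  have u: "integrable lborel (u n)" "integral\<^sup>L lborel (u n) \<le> 2 * A" for n
  proof -
    let ?e = "1 / real (Suc n)"
    have e: "?e > 0" by simp
    note reg = stft_regularised[OF I f f e]
    \<comment> \<open>The integrand is real; writing it as a multiple of the unit quaternion 1 lets
      the norm recover the real integral.\<close>
    have eq: "gauss (?e * snd p) *\<^sub>R (qcnj (stft I f p) * stft I f p) = u n p *\<^sub>R 1" for p
      by (simp add: u_def qcnj_mult_self of_real_def)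
    show int: "integrable lborel (u n)"
      using integrable_norm[OF reg(1)] unfolding eq by (simp add: u_def[abs_def] abs_mult)
    have "0 \<le> integral\<^sup>L lborel (u n)"
      by (simp add: u_def)
    then have "integral\<^sup>L lborel (u n) = norm (LINT p|lborel. u n p *\<^sub>R (1 :: quat))"
      using int by simp
    also have "\<dots> \<le> (LINT z|lborel. norm ((2 * (gauss ((fst z - snd z) / ?e) / ?e * gauss ((fst z - snd z) / sqrt 2)))
        *\<^sub>R (qcnj (f (fst z)) * f (snd z))))"
      unfolding eq[symmetric] reg(3) by (rule integral_norm_bound)
    also have "\<dots> \<le> (LINT z|lborel. 2 * (gauss ((fst z - snd z) / ?e) / ?e * (norm (f (fst z)) * norm (f (snd z)))))"
    proof (intro integral_mono integrable_norm reg(2) integrable_mult_right gauss_kernel_integrable(1)[OF f f e])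
      fix z :: "real \<times> real"
      have "gauss ((fst z - snd z) / ?e) / ?e * gauss ((fst z - snd z) / sqrt 2) \<le> gauss ((fst z - snd z) / ?e) / ?e * 1"
        by (intro mult_left_mono) simp_all
      then have "2 * (gauss ((fst z - snd z) / ?e) / ?e * gauss ((fst z - snd z) / sqrt 2)) * (norm (f (fst z)) * norm (f (snd z)))
          \<le> 2 * (gauss ((fst z - snd z) / ?e) / ?e) * (norm (f (fst z)) * norm (f (snd z)))"
        by (intro mult_right_mono) simp_all
      then show "norm ((2 * (gauss ((fst z - snd z) / ?e) / ?e * gauss ((fst z - snd z) / sqrt 2)))
          *\<^sub>R (qcnj (f (fst z)) * f (snd z))) \<le> 2 * (gauss ((fst z - snd z) / ?e) / ?e * (norm (f (fst z)) * norm (f (snd z))))"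
        by (simp add: norm_quat_mult abs_mult mult.assoc)
    qed
    also have "\<dots> \<le> 2 * A"
      using gauss_kernel_integrable(2)[OF f f e] by (simp add: A_def)
    finally show "integral\<^sup>L lborel (u n) \<le> 2 * A" .
  qed
  have lim: "(\<lambda>n. u n p) \<longlonglongrightarrow> (norm (stft I f p))\<^sup>2" for p
  proof -
    have "(\<lambda>n. u n p) \<longlonglongrightarrow> 1 * (norm (stft I f p))\<^sup>2"
      unfolding u_def by (intro tendsto_mult tendsto_const tendsto_gauss_1 inverse_Suc_mult_tendsto_0)
    then show ?thesis by simp
  qed
  have "integrable lborel (\<lambda>p. (norm (stft I f p))\<^sup>2)" "(LINT p|lborel. (norm (stft I f p))\<^sup>2) \<le> 2 * A"
  proof -
    have u_nonneg: "0 \<le> u n p" for n p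
      by (simp add: u_def)
    have "(\<lambda>p. (norm (stft I f p))\<^sup>2) \<in> borel_measurable lborel"
      by measurable
    note Fatou = integral_Fatou[OF u(1) u_nonneg this AE_I2[OF lim] always_eventually]
    show "integrable lborel (\<lambda>p. (norm (stft I f p))\<^sup>2)" "(LINT p|lborel. (norm (stft I f p))\<^sup>2) \<le> 2 * A"
      by (rule Fatou[of "2 * A"]; use A u(2) in simp)+
  qed
  then show "stft I f \<in> L2 lborel" "(LINT p|lborel. (norm (stft I f p))\<^sup>2) \<le> 2 * (LINT t|lborel. (norm (f t))\<^sup>2)"
    by (simp_all add: L2_def A_def)
qed

section \<open>Interval indicators as test functions\<close>

lemma L2_indicator_interval: "(\<lambda>x::real. of_real (indicator {a..b} x)) \<in> L2 lborel"
proof (rule L2I)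
  show "(\<lambda>x. of_real (indicator {a..b} x) :: quat) \<in> borel_measurable lborel"
    unfolding of_real_def by measurable
  show "integrable lborel (indicator {a..b} :: real \<Rightarrow> real)"
    by (rule integrable_real_indicator) (auto simp: less_top[symmetric] emeasure_lborel_Icc_eq)
qed (auto simp: indicator_def)

lemma shifted_interval_integral:
  fixes f :: "real \<Rightarrow> quat"
  assumes f: "f \<in> L2 lborel"
  shows "integrable lborel (\<lambda>t. indicator {a..b} (t + \<delta>) *\<^sub>R f t)"
    and "(LINT t|lborel. norm (indicator {a..b} (t + \<delta>) *\<^sub>R f t)) \<le> \<bar>b - a\<bar> + (LINT t|lborel. (norm (f t))\<^sup>2)"
proof -
  have [measurable]: "f \<in> borel_measurable borel"
    using L2_measurable[OF f] by simp
  have ind: "indicator {a..b} (t + \<delta>) = (indicator {a - \<delta>..b - \<delta>} t :: real)" for t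
    by (auto simp: indicator_def)
  have "integrable lborel (indicator {a - \<delta>..b - \<delta>} :: real \<Rightarrow> real)"
    by (rule integrable_real_indicator) (auto simp: less_top[symmetric] emeasure_lborel_Icc_eq)
  then have b: "integrable lborel (\<lambda>t. indicator {a - \<delta>..b - \<delta>} t + (norm (f t))\<^sup>2)"
    by (intro Bochner_Integration.integrable_add L2_integrable_norm2 f)
  have le: "norm (indicator {a..b} (t + \<delta>) *\<^sub>R f t) \<le> indicator {a - \<delta>..b - \<delta>} t + (norm (f t))\<^sup>2" for t
  proof -
    have "norm (f t) \<le> 1 + (norm (f t))\<^sup>2"
      by (rule norm_le_1_plus_norm2)
    then show ?thesis
      by (auto simp: indicator_def)
  qed
  show int: "integrable lborel (\<lambda>t. indicator {a..b} (t + \<delta>) *\<^sub>R f t)"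
    by (rule Bochner_Integration.integrable_bound[OF b], measurable, intro AE_I2 order_trans[OF le], simp)
  have "(LINT t|lborel. norm (indicator {a..b} (t + \<delta>) *\<^sub>R f t)) \<le> (LINT t|lborel. indicator {a - \<delta>..b - \<delta>} t + (norm (f t))\<^sup>2)"
    by (intro integral_mono integrable_norm int b le)
  also have "\<dots> = measure lborel {a - \<delta>..b - \<delta>} + (LINT t|lborel. (norm (f t))\<^sup>2)"
    using L2_integrable_norm2[OF f] \<open>integrable lborel (indicator _)\<close> by simp
  \<comment> \<open>The absolute value covers empty intervals, whose measure is 0 although
    \<open>b - a\<close> is negative.\<close>
  also have "\<dots> \<le> \<bar>b - a\<bar> + (LINT t|lborel. (norm (f t))\<^sup>2)"
    by (cases "a - \<delta> \<le> b - \<delta>") auto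
  finally show "(LINT t|lborel. norm (indicator {a..b} (t + \<delta>) *\<^sub>R f t)) \<le> \<bar>b - a\<bar> + (LINT t|lborel. (norm (f t))\<^sup>2)" .
qed

lemma shifted_interval_integral_tendsto:
  fixes f :: "real \<Rightarrow> quat"
  assumes f: "f \<in> L2 lborel" and \<delta>: "\<delta> \<longlonglongrightarrow> 0"
  shows "(\<lambda>n. LINT t|lborel. indicator {a..b} (t + \<delta> n) *\<^sub>R f t) \<longlonglongrightarrow> (LINT t|lborel. indicator {a..b} t *\<^sub>R f t)"
proof -
  have [measurable]: "f \<in> borel_measurable borel"
    using L2_measurable[OF f] by simp
  \<comment> \<open>A convergent sequence of shifts is bounded, so all shifted intervals lie in a
    single enlarged interval, whose indicator dominates.\<close>
  obtain K where K: "\<And>n. \<bar>\<delta> n\<bar> \<le> K"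
    using convergent_imp_Bseq[OF convergentI[OF \<delta>]] by (auto simp: Bseq_def)
  show ?thesis
  proof (rule integral_dominated_convergence)
    show "integrable lborel (\<lambda>t. norm (indicator {a - K..b + K} (t + 0) *\<^sub>R f t))"
      by (intro integrable_norm shifted_interval_integral f)
    \<comment> \<open>The indicator is discontinuous only at the endpoints, which form a null
      set.\<close>
    have "AE t in lborel. t \<noteq> a" "AE t in lborel. t \<noteq> b"
      by (rule AE_lborel_singleton)+
    then show "AE t in lborel. (\<lambda>n. indicator {a..b} (t + \<delta> n) *\<^sub>R f t) \<longlonglongrightarrow> indicator {a..b} t *\<^sub>R f t"
    proof eventually_elim
      fix t assume "t \<noteq> a" "t \<noteq> b"
      then have "t \<notin> frontier {a..b}"
        by (auto simp: frontier_def interior_atLeastAtMost_real)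
      then have "isCont (indicator {a..b} :: real \<Rightarrow> real) t"
        by (simp add: isCont_indicator)
      moreover have "(\<lambda>n. t + \<delta> n) \<longlonglongrightarrow> t"
        using tendsto_add[OF tendsto_const \<delta>, of t] by simp
      ultimately have "(\<lambda>n. indicator {a..b} (t + \<delta> n) :: real) \<longlonglongrightarrow> indicator {a..b} t"
        by (rule isCont_tendsto_compose)
      then show "(\<lambda>n. indicator {a..b} (t + \<delta> n) *\<^sub>R f t) \<longlonglongrightarrow> indicator {a..b} t *\<^sub>R f t"
        by (intro tendsto_intros)
    qed
    fix n
    have "norm (indicator {a..b} (t + \<delta> n) *\<^sub>R f t) \<le> norm (indicator {a - K..b + K} (t + 0) *\<^sub>R f t)" for t
      using K[of n] by (auto simp: indicator_def)
    then show "AE t in lborel. norm (indicator {a..b} (t + \<delta> n) *\<^sub>R f t) \<le> norm (indicator {a - K..b + K} (t + 0) *\<^sub>R f t)"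
      by simp
  qed measurable
qed

text \<open>The substitution \<open>s = t + e * u\<close> turns the regularised inner product into a
  Gaussian average of integrals of \<open>f\<close> over intervals shifted by \<open>e * u\<close>.
  As \<open>e\<close> tends to 0, the shifts disappear and the weights tend to
  \<open>2 * gauss u\<close>, of total mass 2.\<close>

lemma stft_inner_indicator:
  assumes I: "I \<in> quat_sphere" and f: "f \<in> L2 lborel"
  shows "L2_inner lborel (stft I f) (stft I (\<lambda>x. of_real (indicator {a..b} x)))
    = 2 *\<^sub>R (LINT t|lborel. indicator {a..b} t *\<^sub>R f t)"
proof -
  have [measurable]: "f \<in> borel_measurable borel"
    using L2_measurable[OF f] by simp
  define h :: "real \<Rightarrow> quat" where "h x = of_real (indicator {a..b} x)" for x
  have h: "h \<in> L2 lborel"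
    unfolding h_def[abs_def] by (rule L2_indicator_interval)
  note V = stft_bound(1)[OF I]
  have [measurable]: "stft I f \<in> borel_measurable borel" "stft I h \<in> borel_measurable borel"
    using f h by (auto intro: stft_measurable)
  define J where "J \<delta> = (LINT t|lborel. indicator {a..b} (t + \<delta>) *\<^sub>R f t)" for \<delta>
  define C where "C = \<bar>b - a\<bar> + (LINT t|lborel. (norm (f t))\<^sup>2)"
  have J_bound: "norm (J \<delta>) \<le> C" for \<delta>
    unfolding J_def C_def by (rule order_trans[OF integral_norm_bound shifted_interval_integral(2)[OF f]])
  have J_meas [measurable]: "J \<in> borel_measurable borel"
    unfolding J_def[abs_def] by measurable
  \<comment> \<open>The kernel after the substitution; its factor \<open>1 / e\<close> is absorbed
    by the Jacobian.\<close>
  define Q where "Q e u = 2 * (gauss u * gauss (e * u / sqrt 2))" for e u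
  have Q_meas [measurable]: "Q e \<in> borel_measurable borel" for e
    unfolding Q_def[abs_def] by measurable
  have Q_bound: "0 \<le> Q e u" "Q e u \<le> 2 * gauss u" for e u
    using mult_left_mono[of "gauss (e * u / sqrt 2)" 1 "gauss u"] by (simp_all add: Q_def)
  have g: "integrable lborel gauss" "integral\<^sup>L lborel gauss = 1"
    using integrable_gauss[of 1 0] integral_gauss[of 1 0] by simp_all
  let ?R = "\<lambda>e p. gauss (e * snd p) *\<^sub>R (qcnj (stft I h p) * stft I f p)"
  have reg: "integral\<^sup>L lborel (?R e) = (LINT u|lborel. Q e u *\<^sub>R J (e * u))" if e: "e > 0" for e
  proof -
    let ?k = "\<lambda>r. 2 * (gauss (r / e) / e * gauss (r / sqrt 2))"
    let ?S = "\<lambda>s t. ?k (s - t) *\<^sub>R (qcnj (h s) * f t)"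
    note r = stft_regularised[OF I h f e]
    have "integral\<^sup>L lborel (?R e) = (LINT z|lborel. ?S (fst z) (snd z))"
      by (rule r(3))
    also have "\<dots> = (LINT t|lborel. LINT s|lborel. ?S s t)"
      using lborel_pair.integral_snd[of ?S] r(2) by (simp add: lborel_prod case_prod_beta')
    also have "\<dots> = (LINT t|lborel. LINT u|lborel. Q e u *\<^sub>R (indicator {a..b} (t + e * u) *\<^sub>R f t))"
    proof (rule Bochner_Integration.integral_cong[OF refl])
      fix t
      have "(LINT s|lborel. ?S s t) = \<bar>e\<bar> *\<^sub>R (LINT u|lborel. ?S (t + e * u) t)"
        using e by (intro lborel_integral_real_affine) simp
      also have "\<dots> = (LINT u|lborel. e *\<^sub>R ?S (t + e * u) t)"
        using e unfolding integral_scaleR_right by simp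
      also have "\<dots> = (LINT u|lborel. Q e u *\<^sub>R (indicator {a..b} (t + e * u) *\<^sub>R f t))"
        using e by (intro Bochner_Integration.integral_cong refl)
          (simp add: Q_def h_def qcnj_scaleR qcnj_1 of_real_def)
      finally show "(LINT s|lborel. ?S s t) = (LINT u|lborel. Q e u *\<^sub>R (indicator {a..b} (t + e * u) *\<^sub>R f t))" .
    qed
    also have "\<dots> = (LINT u|lborel. LINT t|lborel. Q e u *\<^sub>R (indicator {a..b} (t + e * u) *\<^sub>R f t))"
    proof (rule lborel_Fubini(4))
      show "(\<lambda>(t, u). Q e u *\<^sub>R (indicator {a..b} (t + e * u) *\<^sub>R f t)) \<in> borel_measurable (lborel \<Otimes>\<^sub>M lborel)"
        by measurable
      show "integrable lborel (\<lambda>t. Q e u *\<^sub>R (indicator {a..b} (t + e * u) *\<^sub>R f t))" for u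
        by (intro integrable_scaleR_right shifted_interval_integral f)
      show "integrable lborel (\<lambda>u. LINT t|lborel. norm (Q e u *\<^sub>R (indicator {a..b} (t + e * u) *\<^sub>R f t)))"
      proof (rule Bochner_Integration.integrable_bound)
        show "integrable lborel (\<lambda>u. 2 * gauss u * C)"
          using g by simp
        have "norm (LINT t|lborel. norm (Q e u *\<^sub>R (indicator {a..b} (t + e * u) *\<^sub>R f t))) \<le> norm (2 * gauss u * C)" for u
        proof -
          let ?v = "\<lambda>t. indicator {a..b} (t + e * u) *\<^sub>R f t"
          have "norm (LINT t|lborel. norm (Q e u *\<^sub>R ?v t)) = Q e u * (LINT t|lborel. norm (?v t))"
            unfolding norm_scaleR[of "Q e u"] integral_mult_right_zero abs_of_nonneg[OF Q_bound(1)]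
            by (simp only: real_norm_def abs_mult abs_of_nonneg[OF Q_bound(1)]
                abs_of_nonneg[OF Bochner_Integration.integral_nonneg[OF norm_ge_zero]])
          also have "\<dots> \<le> 2 * gauss u * C"
            unfolding C_def by (intro mult_mono Q_bound shifted_interval_integral(2)[OF f]) simp_all
          finally show ?thesis
            by simp
        qed
        then show "AE u in lborel. norm (LINT t|lborel. norm (Q e u *\<^sub>R (indicator {a..b} (t + e * u) *\<^sub>R f t))) \<le> norm (2 * gauss u * C)"
          by (rule AE_I2)
      qed measurable
    qed
    also have "\<dots> = (LINT u|lborel. Q e u *\<^sub>R J (e * u))"
      by (simp only: J_def integral_scaleR_right)
    finally show ?thesis .
  qed
  define e where "e n = 1 / real (Suc n)" for n
  have e_pos: "e n > 0" for n
    by (simp add: e_def)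
  have e_lim: "(\<lambda>n. e n * c) \<longlonglongrightarrow> 0" for c
    unfolding e_def by (rule inverse_Suc_mult_tendsto_0)
  \<comment> \<open>The same sequence is passed to the limit twice. Here the dominating function is
    the norm of the unregularised integrand, integrable by \<open>stft_bound\<close>; on the
    averaged side it is \<open>2 * gauss u * C\<close>.\<close>
  have "(\<lambda>n. integral\<^sup>L lborel (?R (e n))) \<longlonglongrightarrow> L2_inner lborel (stft I f) (stft I h)"
    unfolding L2_inner_def
  proof (rule integral_dominated_convergence)
    show "integrable lborel (\<lambda>p. norm (qcnj (stft I h p) * stft I f p))"
      by (intro integrable_norm L2_integrable_inner V f h)
    have "(\<lambda>n. ?R (e n) p) \<longlonglongrightarrow> 1 *\<^sub>R (qcnj (stft I h p) * stft I f p)" for p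
      by (intro tendsto_scaleR tendsto_const tendsto_gauss_1 e_lim)
    then show "AE p in lborel. (\<lambda>n. ?R (e n) p) \<longlonglongrightarrow> qcnj (stft I h p) * stft I f p"
      by simp
    show "AE p in lborel. norm (?R (e n) p) \<le> norm (qcnj (stft I h p) * stft I f p)" for n
      by (intro AE_I2) (simp add: mult_left_le_one_le)
  qed measurable
  moreover have "(\<lambda>n. integral\<^sup>L lborel (?R (e n))) \<longlonglongrightarrow> (LINT u|lborel. (2 * gauss u) *\<^sub>R J 0)"
  proof -
    have "(\<lambda>n. LINT u|lborel. Q (e n) u *\<^sub>R J (e n * u)) \<longlonglongrightarrow> (LINT u|lborel. (2 * gauss u) *\<^sub>R J 0)"
    proof (rule integral_dominated_convergence)
      show "integrable lborel (\<lambda>u. 2 * gauss u * C)"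
        using g by simp
      have "(\<lambda>n. Q (e n) u *\<^sub>R J (e n * u)) \<longlonglongrightarrow> (2 * (gauss u * 1)) *\<^sub>R J 0" for u
      proof (intro tendsto_scaleR)
        have "(\<lambda>n. e n * (u / sqrt 2)) \<longlonglongrightarrow> 0"
          by (rule e_lim)
        then show "(\<lambda>n. Q (e n) u) \<longlonglongrightarrow> 2 * (gauss u * 1)"
          unfolding Q_def times_divide_eq_right by (intro tendsto_mult tendsto_const tendsto_gauss_1)
        show "(\<lambda>n. J (e n * u)) \<longlonglongrightarrow> J 0"
          using shifted_interval_integral_tendsto[OF f e_lim[of u]] by (simp add: J_def)
      qed
      then show "AE u in lborel. (\<lambda>n. Q (e n) u *\<^sub>R J (e n * u)) \<longlonglongrightarrow> (2 * gauss u) *\<^sub>R J 0"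
        by simp
      show "AE u in lborel. norm (Q (e n) u *\<^sub>R J (e n * u)) \<le> 2 * gauss u * C" for n
        unfolding norm_scaleR abs_of_nonneg[OF Q_bound(1)]
        by (intro AE_I2 mult_mono Q_bound J_bound) simp_all
    qed measurable
    then show ?thesis
      by (simp only: reg[OF e_pos])
  qed
  ultimately have "L2_inner lborel (stft I f) (stft I h) = (LINT u|lborel. (2 * gauss u) *\<^sub>R J 0)"
    by (rule LIMSEQ_unique)
  also have "\<dots> = 2 *\<^sub>R J 0"
    using g by simp
  finally show ?thesis
    by (simp add: h_def[abs_def] J_def)
qed

section \<open>The synthesis operator\<close>

text \<open>Intended for integrable \<open>G\<close>, for which the integral converges absolutely at
  every \<open>y\<close>; truncations of square integrable functions to squares are of this
  kind.\<close>

definition synth_integral :: "quat \<Rightarrow> (real \<times> real \<Rightarrow> quat) \<Rightarrow> real \<Rightarrow> quat" where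
  "synth_integral I G y = (2 powr (3/4)) *\<^sub>R (LINT p|lborel. synth_integrand I G y p)"

lemma synth_integrand_eq:
  "synth_integrand I G y p = gauss (y - fst p) *\<^sub>R (qexp I (2 * pi * y * snd p) * G p)"
  by (simp add: synth_integrand_def case_prod_beta' gauss_def qexp_def of_real_def mult_ac)

lemma synth_on_eq_synth_integral: "synth_on D I F = synth_integral I (\<lambda>p. indicator D p *\<^sub>R F p)"
  by (simp add: fun_eq_iff synth_on_def synth_integral_def set_lebesgue_integral_def synth_integrand_eq mult_ac)

lemma synth_integrand_integrable:
  assumes I: "I \<in> quat_sphere" and G: "integrable lborel G"
  shows "integrable lborel (synth_integrand I G y)"
proof -
  have [measurable]: "G \<in> borel_measurable borel"
    using borel_measurable_integrable[OF G] by simp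
  show ?thesis
    unfolding synth_integrand_eq[abs_def]
    by (rule Bochner_Integration.integrable_bound[OF G])
      (simp_all add: norm_quat_mult I mult_left_le_one_le)
qed

lemma synth_integral_diff:
  assumes I: "I \<in> quat_sphere" and "integrable lborel G" "integrable lborel H"
  shows "synth_integral I (\<lambda>p. G p - H p) y = synth_integral I G y - synth_integral I H y"
proof -
  have "synth_integrand I (\<lambda>p. G p - H p) y p = synth_integrand I G y p - synth_integrand I H y p" for p
    by (simp add: synth_integrand_eq right_diff_distrib scaleR_right_diff_distrib)
  then show ?thesis
    using synth_integrand_integrable[OF I assms(2), of y] synth_integrand_integrable[OF I assms(3), of y]
    by (simp add: synth_integral_def scaleR_right_diff_distrib)
qed

text \<open>The integral is bounded in two ways: by the constant integral of the norm of
  \<open>G\<close>, and by the Gaussian smoothing \<open>B\<close>, which is integrable in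
  \<open>y\<close>. The product of the two bounds dominates the square.\<close>

lemma synth_integral_L2:
  assumes I: "I \<in> quat_sphere" and G: "integrable lborel G"
  shows "synth_integral I G \<in> L2 lborel"
proof -
  have [measurable]: "G \<in> borel_measurable borel"
    using borel_measurable_integrable[OF G] by simp
  define B where "B y = (LINT p|lborel. gauss (y - fst p) * norm (G p))" for y
  have g: "integrable lborel (\<lambda>y. gauss (y - x))" "(LINT y|lborel. gauss (y - x)) = 1" for x
    using integrable_gauss[of 1 "- x"] integral_gauss[of 1 "- x"] by simp_all
  have B: "integrable lborel B"
    unfolding B_def[abs_def]
  proof (rule lborel_Fubini(2))
    show "(\<lambda>(y, p). gauss (y - fst p) * norm (G p)) \<in> borel_measurable (lborel \<Otimes>\<^sub>M lborel)"
      by measurable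
  qed (use g G in \<open>simp_all add: abs_mult\<close>)
  define T where "T y = (LINT p|lborel. synth_integrand I G y p)" for y
  have T_B: "norm (T y) \<le> B y" for y
    using integral_norm_bound[of lborel "synth_integrand I G y"]
    by (simp add: B_def T_def synth_integrand_eq[abs_def] norm_quat_mult I)
  have T_G: "norm (T y) \<le> (LINT p|lborel. norm (G p))" for y
  proof -
    have "norm (T y) \<le> (LINT p|lborel. norm (synth_integrand I G y p))"
      unfolding T_def by (rule integral_norm_bound)
    also have "\<dots> \<le> (LINT p|lborel. norm (G p))"
      by (intro integral_mono integrable_norm synth_integrand_integrable I G)
        (simp add: synth_integrand_eq norm_quat_mult I mult_left_le_one_le)
    finally show ?thesis .
  qed
  have "T \<in> L2 lborel"
  proof (rule L2I)
    show "T \<in> borel_measurable lborel"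
      unfolding T_def[abs_def] synth_integrand_eq by measurable
    show "integrable lborel (\<lambda>y. (LINT p|lborel. norm (G p)) * B y)"
      using B by simp
    show "AE y in lborel. (norm (T y))\<^sup>2 \<le> (LINT p|lborel. norm (G p)) * B y"
      unfolding power2_eq_square by (intro AE_I2 mult_mono T_B T_G) simp_all
  qed
  then show ?thesis
    unfolding synth_integral_def[abs_def] T_def[symmetric] by (rule L2_scaleR)
qed

text \<open>Fubini's theorem applies because \<open>G\<close> is integrable and the Gaussian average
  of \<open>h\<close> is uniformly bounded. Conjugation turns the phase acting on \<open>G\<close>
  into the opposite phase acting on \<open>h\<close>, so no quaternion factors have to be
  commuted.\<close>

lemma synth_integral_inner:
  assumes I: "I \<in> quat_sphere" and G: "integrable lborel G" and h: "h \<in> L2 lborel"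
  shows "L2_inner lborel (synth_integral I G) h = L2_inner lborel G (stft I h)"
proof -
  have [measurable]: "G \<in> borel_measurable borel" "h \<in> borel_measurable borel"
    using borel_measurable_integrable[OF G] L2_measurable[OF h] by simp_all
  define \<Phi> where "\<Phi> y p = (2 powr (3/4)) *\<^sub>R (qcnj (h y) * synth_integrand I G y p)" for y p
  have \<Phi>: "\<Phi> y p = qcnj ((2 powr (3/4)) *\<^sub>R (gauss (y - fst p) *\<^sub>R (qexp I (- (2 * pi * y * snd p)) * h y))) * G p" for y p
    by (simp add: \<Phi>_def synth_integrand_eq qcnj_scaleR qcnj_mult qcnj_qexp[OF I] mult.assoc)
  have st: "integrable lborel (\<lambda>y. qcnj ((2 powr (3/4)) *\<^sub>R (gauss (y - fst p) *\<^sub>R (qexp I (- (2 * pi * y * snd p)) * h y))))"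
    "(LINT y|lborel. qcnj ((2 powr (3/4)) *\<^sub>R (gauss (y - fst p) *\<^sub>R (qexp I (- (2 * pi * y * snd p)) * h y)))) = qcnj (stft I h p)" for p
  proof -
    have int: "integrable lborel (\<lambda>y. (2 powr (3/4)) *\<^sub>R (gauss (y - fst p) *\<^sub>R (qexp I (- (2 * pi * y * snd p)) * h y)))"
      by (intro integrable_scaleR_right stft_integrable I h)
    show "integrable lborel (\<lambda>y. qcnj ((2 powr (3/4)) *\<^sub>R (gauss (y - fst p) *\<^sub>R (qexp I (- (2 * pi * y * snd p)) * h y))))"
      by (rule integrable_bounded_linear[OF bounded_linear_qcnj int])
    show "(LINT y|lborel. qcnj ((2 powr (3/4)) *\<^sub>R (gauss (y - fst p) *\<^sub>R (qexp I (- (2 * pi * y * snd p)) * h y)))) = qcnj (stft I h p)"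
      unfolding integral_bounded_linear[OF bounded_linear_qcnj int] stft_def integral_scaleR_right ..
  qed
  have "L2_inner lborel (synth_integral I G) h = (LINT y|lborel. LINT p|lborel. \<Phi> y p)"
    unfolding L2_inner_def
  proof (rule Bochner_Integration.integral_cong[OF refl])
    fix y
    show "qcnj (h y) * synth_integral I G y = (LINT p|lborel. \<Phi> y p)"
      using synth_integrand_integrable[OF I G, of y] by (simp add: \<Phi>_def synth_integral_def)
  qed
  also have "\<dots> = (LINT p|lborel. LINT y|lborel. \<Phi> y p)"
  proof (rule lborel_Fubini(4))
    show "(\<lambda>(y, p). \<Phi> y p) \<in> borel_measurable (lborel \<Otimes>\<^sub>M lborel)"
      unfolding \<Phi> by measurable
    show "integrable lborel (\<lambda>y. \<Phi> y p)" for p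
      unfolding \<Phi> by (intro Bochner_Integration.integrable_mult_left st)
    define C where "C = 2 powr (3/4) * (1 + (LINT t|lborel. (norm (h t))\<^sup>2))"
    show "integrable lborel (\<lambda>p. LINT y|lborel. norm (\<Phi> y p))"
    proof (rule Bochner_Integration.integrable_bound)
      show "integrable lborel (\<lambda>p. C * norm (G p))"
        using G by simp
      have "norm (LINT y|lborel. norm (\<Phi> y p)) \<le> norm (C * norm (G p))" for p
      proof -
        have "(LINT y|lborel. norm (\<Phi> y p)) = (LINT y|lborel. (2 powr (3/4) * norm (G p)) * (gauss (y - fst p) * norm (h y)))"
          by (intro Bochner_Integration.integral_cong refl) (simp add: \<Phi> norm_quat_mult I)
        also have "\<dots> = (2 powr (3/4) * norm (G p)) * (LINT y|lborel. gauss (y - fst p) * norm (h y))"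
          by (rule integral_mult_right_zero)
        also have "\<dots> \<le> (2 powr (3/4) * norm (G p)) * (1 + (LINT t|lborel. (norm (h t))\<^sup>2))"
          by (intro mult_left_mono gauss_L2_integrable(2)[OF h]) simp
        also have "\<dots> = C * norm (G p)"
          by (simp add: C_def)
        finally have "(LINT y|lborel. norm (\<Phi> y p)) \<le> C * norm (G p)" .
        moreover have "0 \<le> (LINT y|lborel. norm (\<Phi> y p))"
          by simp
        ultimately show ?thesis
          by simp
      qed
      then show "AE p in lborel. norm (LINT y|lborel. norm (\<Phi> y p)) \<le> norm (C * norm (G p))"
        by simp
      show "(\<lambda>p. LINT y|lborel. norm (\<Phi> y p)) \<in> borel_measurable lborel"
        unfolding \<Phi> by measurable
    qed
  qed
  also have "\<dots> = L2_inner lborel G (stft I h)"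
    unfolding L2_inner_def
  proof (rule Bochner_Integration.integral_cong[OF refl])
    fix p
    have "(LINT y|lborel. \<Phi> y p) = (LINT y|lborel. qcnj ((2 powr (3/4)) *\<^sub>R (gauss (y - fst p) *\<^sub>R (qexp I (- (2 * pi * y * snd p)) * h y)))) * G p"
      unfolding \<Phi> by (intro Bochner_Integration.integral_mult_left st)
    then show "(LINT y|lborel. \<Phi> y p) = qcnj (stft I h p) * G p"
      unfolding st(2) .
  qed
  finally show ?thesis .
qed

text \<open>Duality: pairing the synthesis integral with itself and moving it across by
  \<open>synth_integral_inner\<close> bounds the squared energy by \<open>?g * (2 * ?u)\<close>. One
  factor \<open>?u\<close> is then cancelled, whence the separate case of zero energy.\<close>

lemma synth_integral_bound:
  assumes I: "I \<in> quat_sphere" and G: "integrable lborel G" "G \<in> L2 lborel"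
  shows "(LINT y|lborel. (norm (synth_integral I G y))\<^sup>2) \<le> 2 * (LINT p|lborel. (norm (G p))\<^sup>2)" (is "?u \<le> 2 * ?g")
proof (cases "?u = 0")
  case False
  have u: "synth_integral I G \<in> L2 lborel"
    by (rule synth_integral_L2[OF I G(1)])
  have "?u > 0"
    using False by (simp add: less_le)
  have "L2_inner lborel G (stft I (synth_integral I G)) = of_real ?u"
    using synth_integral_inner[OF I G(1) u] L2_inner_self[OF u] by simp
  then have "?u\<^sup>2 \<le> ?g * (LINT p|lborel. (norm (stft I (synth_integral I G) p))\<^sup>2)"
    using L2_inner_bound[OF G(2) stft_bound(1)[OF I u]] by simp
  also have "\<dots> \<le> ?g * (2 * ?u)"
    by (intro mult_left_mono stft_bound(2)[OF I u]) simp
  finally have "?u * ?u \<le> (2 * ?g) * ?u"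
    by (simp add: power2_eq_square mult_ac)
  with \<open>?u > 0\<close> show ?thesis
    by (simp only: mult_le_cancel_right_pos)
qed simp

section \<open>Truncation to squares and the limit in the mean\<close>

abbreviation square :: "nat \<Rightarrow> (real \<times> real) set" where
  "square n \<equiv> cbox (- real n, - real n) (real n, real n)"

lemma L2_cutoff_integrable:
  assumes F: "F \<in> L2 lborel"
  shows "integrable lborel (\<lambda>p. indicator (square n) p *\<^sub>R F p)"
proof (rule Bochner_Integration.integrable_bound)
  have [measurable]: "F \<in> borel_measurable borel"
    using L2_measurable[OF F] by simp
  show "integrable lborel (\<lambda>p. indicator (square n) p + (norm (F p))\<^sup>2)"
    by (intro Bochner_Integration.integrable_add L2_integrable_norm2 F integrable_real_indicator
        emeasure_lborel_cbox_finite) simp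
  show "(\<lambda>p. indicator (square n) p *\<^sub>R F p) \<in> borel_measurable lborel"
    by measurable
  have "norm (F p) \<le> 1 + (norm (F p))\<^sup>2" for p
    by (rule norm_le_1_plus_norm2)
  then show "AE p in lborel. norm (indicator (square n) p *\<^sub>R F p) \<le> norm (indicator (square n) p + (norm (F p))\<^sup>2)"
    by (intro AE_I2) (simp add: indicator_def)
qed

lemma square_mono: "m \<le> n \<Longrightarrow> square m \<subseteq> square n"
  by (auto simp: cbox_Pair_eq)

lemma eventually_in_square: "\<forall>\<^sub>F n in sequentially. p \<in> square n"
proof -
  obtain N where N: "max \<bar>fst p\<bar> \<bar>snd p\<bar> \<le> real N"
    using real_arch_simple by blast
  have "p \<in> square n" if "n \<ge> N" for n
    using that N by (cases p) (auto simp: cbox_Pair_eq)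
  then show ?thesis
    by (auto simp: eventually_sequentially)
qed

lemma cutoff_tendsto: "(\<lambda>n. indicator (square n) p *\<^sub>R (c :: quat)) \<longlonglongrightarrow> c"
  by (rule tendsto_eventually) (use eventually_in_square[of p] in \<open>auto elim: eventually_mono\<close>)

lemma L2_cutoff_tendsto:
  assumes F: "F \<in> L2 lborel"
  shows "(\<lambda>n. LINT p|lborel. (norm (indicator (square n) p *\<^sub>R F p - F p))\<^sup>2) \<longlonglongrightarrow> 0"
proof -
  have [measurable]: "F \<in> borel_measurable borel"
    using L2_measurable[OF F] by simp
  have "(\<lambda>n. LINT p|lborel. (norm (indicator (square n) p *\<^sub>R F p - F p))\<^sup>2) \<longlonglongrightarrow> (LINT p|lborel. (norm (F p - F p))\<^sup>2)"
  proof (rule integral_dominated_convergence)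
    show "integrable lborel (\<lambda>p. (norm (F p))\<^sup>2)"
      by (rule L2_integrable_norm2[OF F])
    show "AE p in lborel. (\<lambda>n. (norm (indicator (square n) p *\<^sub>R F p - F p))\<^sup>2) \<longlonglongrightarrow> (norm (F p - F p))\<^sup>2"
      by (intro AE_I2 tendsto_power tendsto_norm tendsto_diff cutoff_tendsto tendsto_const)
    show "AE p in lborel. norm ((norm (indicator (square n) p *\<^sub>R F p - F p))\<^sup>2) \<le> (norm (F p))\<^sup>2" for n
      by (intro AE_I2) (simp add: indicator_def)
  qed measurable
  then show ?thesis
    by simp
qed

text \<open>By linearity, differences of truncated synthesis integrals are synthesis integrals of
  differences of truncations. Their bound makes the sequence Cauchy, and completeness supplies a
  limit for the choice in \<open>synth\<close>.\<close>

lemma is_synth_synth: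
  assumes I: "I \<in> quat_sphere" and F: "F \<in> L2 lborel"
  shows "is_synth I F (synth I F)"
proof -
  define G where "G n p = indicator (square n) p *\<^sub>R F p" for n p
  define u where "u n = synth_on (square n) I F" for n
  have u_eq: "u n = synth_integral I (G n)" for n
    unfolding u_def G_def[abs_def] by (rule synth_on_eq_synth_integral)
  have G1: "integrable lborel (G n)" and G2: "G n \<in> L2 lborel" for n
    unfolding G_def[abs_def] using F by (simp_all add: L2_cutoff_integrable L2_indicator)
  have u: "u n \<in> L2 lborel" for n
    unfolding u_eq by (rule synth_integral_L2[OF I G1])
  have "\<exists>N. \<forall>m\<ge>N. \<forall>n\<ge>N. (LINT y|lborel. (norm (u m y - u n y))\<^sup>2) \<le> e" if e: "e > 0" for e
  proof -
    have "\<forall>\<^sub>F n in sequentially. (LINT p|lborel. (norm (G n p - F p))\<^sup>2) < e / 2"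
      using order_tendstoD(2)[OF L2_cutoff_tendsto[OF F], of "e / 2"] e by (simp add: G_def)
    then obtain N where N: "(LINT p|lborel. (norm (G N p - F p))\<^sup>2) < e / 2"
      by (auto simp: eventually_sequentially)
    have "(LINT y|lborel. (norm (u m y - u n y))\<^sup>2) \<le> e" if "m \<ge> N" "n \<ge> N" for m n
    proof -
      have "(LINT y|lborel. (norm (u m y - u n y))\<^sup>2) = (LINT y|lborel. (norm (synth_integral I (\<lambda>p. G m p - G n p) y))\<^sup>2)"
        by (simp add: u_eq synth_integral_diff[OF I G1 G1])
      also have "\<dots> \<le> 2 * (LINT p|lborel. (norm (G m p - G n p))\<^sup>2)"
        by (intro synth_integral_bound I Bochner_Integration.integrable_diff G1 L2_diff G2)
      \<comment> \<open>Both truncations equal \<open>F\<close> on the square of index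
        \<open>N\<close>, so their difference vanishes there, and elsewhere its norm is at most that
        of \<open>F\<close>.\<close>
      also have "(LINT p|lborel. (norm (G m p - G n p))\<^sup>2) \<le> (LINT p|lborel. (norm (G N p - F p))\<^sup>2)"
        using square_mono[OF \<open>m \<ge> N\<close>] square_mono[OF \<open>n \<ge> N\<close>]
        by (intro integral_mono L2_integrable_norm2 L2_diff G2 F) (auto simp: G_def indicator_def)
      finally show ?thesis
        using N by simp
    qed
    then show ?thesis by blast
  qed
  then obtain g where "g \<in> L2 lborel" "(\<lambda>n. LINT y|lborel. (norm (u n y - g y))\<^sup>2) \<longlonglongrightarrow> 0"
    by (rule L2_complete[of u, OF u])
  then have "is_synth I F g"
    using u unfolding is_synth_def u_def by blast
  then show ?thesis
    unfolding synth_def by (rule someI[of "is_synth I F"])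
qed

text \<open>Along a subsequence the truncated integrals converge almost everywhere to the limit in
  the mean. Wherever the full integral converges absolutely, dominated convergence identifies the
  same limit as that integral.\<close>

lemma synth_eq_integral:
  assumes I: "I \<in> quat_sphere" and F: "F \<in> L2 lborel"
  shows "AE y in lborel. integrable lborel (synth_integrand I F y) \<longrightarrow>
    synth I F y = (2 powr (3/4)) *\<^sub>R (LINT p|lborel. synth_integrand I F y p)"
proof -
  have s: "synth I F \<in> L2 lborel" "\<And>n. synth_on (square n) I F \<in> L2 lborel"
    "(\<lambda>n. LINT y|lborel. (norm (synth_on (square n) I F y - synth I F y))\<^sup>2) \<longlonglongrightarrow> 0"
    using is_synth_synth[OF I F] unfolding is_synth_def by blast+
  obtain r :: "nat \<Rightarrow> nat" where r: "strict_mono r"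
    and ae: "AE y in lborel. (\<lambda>n. synth_on (square (r n)) I F y) \<longlonglongrightarrow> synth I F y"
    using L2_AE_subseq[OF s(2,1,3)] by blast
  from ae show ?thesis
  proof eventually_elim
    fix y
    assume lim: "(\<lambda>n. synth_on (square (r n)) I F y) \<longlonglongrightarrow> synth I F y"
    show "integrable lborel (synth_integrand I F y) \<longrightarrow>
        synth I F y = (2 powr (3/4)) *\<^sub>R (LINT p|lborel. synth_integrand I F y p)"
    proof
      assume int: "integrable lborel (synth_integrand I F y)"
      have [measurable]: "synth_integrand I F y \<in> borel_measurable borel"
        using borel_measurable_integrable[OF int] by simp
      have "(\<lambda>n. LINT p|lborel. indicator (square n) p *\<^sub>R synth_integrand I F y p) \<longlonglongrightarrow> (LINT p|lborel. synth_integrand I F y p)"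
      proof (rule integral_dominated_convergence)
        show "integrable lborel (\<lambda>p. norm (synth_integrand I F y p))"
          by (rule integrable_norm[OF int])
        show "AE p in lborel. (\<lambda>n. indicator (square n) p *\<^sub>R synth_integrand I F y p) \<longlonglongrightarrow> synth_integrand I F y p"
          by (intro AE_I2 cutoff_tendsto)
        show "AE p in lborel. norm (indicator (square n) p *\<^sub>R synth_integrand I F y p) \<le> norm (synth_integrand I F y p)" for n
          by (intro AE_I2) (simp add: indicator_def)
      qed measurable
      then have "(\<lambda>n. synth_on (square n) I F y) \<longlonglongrightarrow> (2 powr (3/4)) *\<^sub>R (LINT p|lborel. synth_integrand I F y p)"
        unfolding synth_on_def set_lebesgue_integral_def by (intro tendsto_intros)
      from LIMSEQ_subseq_LIMSEQ[OF this r] lim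
      show "synth I F y = (2 powr (3/4)) *\<^sub>R (LINT p|lborel. synth_integrand I F y p)"
        unfolding o_def by (rule LIMSEQ_unique[symmetric])
    qed
  qed
qed

text \<open>Both sides are limits of the inner products of the truncated integrals: the left by
  convergence in the mean, the right by duality and convergence of the truncations of
  \<open>F\<close>.\<close>

lemma synth_inner:
  assumes I: "I \<in> quat_sphere" and F: "F \<in> L2 lborel" and h: "h \<in> L2 lborel"
  shows "L2_inner lborel (synth I F) h = L2_inner lborel F (stft I h)"
proof (rule LIMSEQ_unique)
  have "is_synth I F (synth I F)"
    by (rule is_synth_synth[OF I F])
  then show "(\<lambda>n. L2_inner lborel (synth_on (square n) I F) h) \<longlonglongrightarrow> L2_inner lborel (synth I F) h"
    unfolding is_synth_def using h by (intro L2_inner_tendsto) blast+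
  show "(\<lambda>n. L2_inner lborel (synth_on (square n) I F) h) \<longlonglongrightarrow> L2_inner lborel F (stft I h)"
    unfolding synth_on_eq_synth_integral synth_integral_inner[OF I L2_cutoff_integrable[OF F] h]
    by (intro L2_inner_tendsto L2_indicator F stft_bound(1) I h L2_cutoff_tendsto) simp
qed

text \<open>Elements of \<open>L2\<close> are functions, so the adjoint relation determines an
  operator only up to null sets. The inversion formula is therefore asserted almost everywhere and
  for every operator satisfying that relation.\<close>

theorem theorem5p9:
  fixes I :: quat
  assumes "I \<in> quat_sphere"
  shows "(\<forall>F\<in>L2 lborel. is_synth I F (synth I F) \<and>
            (AE y in lborel. integrable lborel (synth_integrand I F y) \<longrightarrow>
               synth I F y = (2 powr (3/4)) *\<^sub>R (LINT p|lborel. synth_integrand I F y p)))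
       \<and> is_L2_adjoint lborel lborel (qstft I) (synth I)
       \<and> (\<forall>V_adj. is_L2_adjoint lborel lborel (qstft I) V_adj \<longrightarrow>
            (\<forall>f\<in>L2 lborel. AE y in lborel. V_adj (qstft I f) y = 2 * f y))"
proof (intro conjI ballI allI impI)
  note I = assms
  fix F :: "real \<times> real \<Rightarrow> quat" assume F: "F \<in> L2 lborel"
  show "is_synth I F (synth I F)"
    by (rule is_synth_synth[OF I F])
  show "AE y in lborel. integrable lborel (synth_integrand I F y) \<longrightarrow>
      synth I F y = (2 powr (3/4)) *\<^sub>R (LINT p|lborel. synth_integrand I F y p)"
    by (rule synth_eq_integral[OF I F])
next
  note I = assms
  show "is_L2_adjoint lborel lborel (qstft I) (synth I)"
    unfolding is_L2_adjoint_def
    using is_synth_synth[OF I] stft_bound(1)[OF I] synth_inner[OF I]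
    by (auto simp: qstft_eq_stft[OF I] is_synth_def)
next
  note I = assms
  fix V_adj :: "(real \<times> real \<Rightarrow> quat) \<Rightarrow> real \<Rightarrow> quat" and f :: "real \<Rightarrow> quat"
  assume adj: "is_L2_adjoint lborel lborel (qstft I) V_adj" and f: "f \<in> L2 lborel"
  define g where "g = V_adj (stft I f)"
  have V: "stft I f \<in> L2 lborel"
    by (rule stft_bound(1)[OF I f])
  have g: "g \<in> L2 lborel"
    using adj V unfolding is_L2_adjoint_def g_def by blast
  define u where "u y = g y - 2 *\<^sub>R f y" for y
  have "AE y in lborel. u y = 0"
  proof (rule AE_eq_0_if_interval_integrals_eq_0)
    fix a b :: real
    have int: "integrable lborel (\<lambda>y. indicator {a..b} y *\<^sub>R v y)" if "v \<in> L2 lborel" for v :: "real \<Rightarrow> quat"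
      using shifted_interval_integral(1)[OF that, of a b 0] by simp
    show "integrable lborel (\<lambda>y. indicator {a..b} y *\<^sub>R u y)"
      unfolding u_def by (intro int L2_diff g L2_scaleR f)
    let ?h = "\<lambda>x. of_real (indicator {a..b} x) :: quat"
    have "(LINT y|lborel. indicator {a..b} y *\<^sub>R g y) = L2_inner lborel g ?h"
      by (simp add: L2_inner_def of_real_def qcnj_scaleR)
    \<comment> \<open>The adjoint relation is tested only against interval indicators, where the
      inner product of the transforms is already known; these integrals determine \<open>g\<close>
      almost everywhere.\<close>
    also have "\<dots> = L2_inner lborel (stft I f) (stft I ?h)"
      using adj V L2_indicator_interval[of a b] unfolding is_L2_adjoint_def g_def
      by (simp add: qstft_eq_stft[OF I L2_indicator_interval])
    also have "\<dots> = 2 *\<^sub>R (LINT y|lborel. indicator {a..b} y *\<^sub>R f y)"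
      by (rule stft_inner_indicator[OF I f])
    finally have gf: "(LINT y|lborel. indicator {a..b} y *\<^sub>R g y) = 2 *\<^sub>R (LINT y|lborel. indicator {a..b} y *\<^sub>R f y)" .
    have "indicator {a..b} y *\<^sub>R u y = indicator {a..b} y *\<^sub>R g y - 2 *\<^sub>R (indicator {a..b} y *\<^sub>R f y)" for y
      by (simp add: u_def scaleR_right_diff_distrib)
    then have "(LINT y|lborel. indicator {a..b} y *\<^sub>R u y)
        = (LINT y|lborel. indicator {a..b} y *\<^sub>R g y) - (LINT y|lborel. 2 *\<^sub>R (indicator {a..b} y *\<^sub>R f y))"
      using int[OF g] int[OF f] by (simp only: Bochner_Integration.integral_diff integrable_scaleR_right)
    also have "\<dots> = 0"
      unfolding integral_scaleR_right gf by simp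
    finally show "(LINT y|lborel. indicator {a..b} y *\<^sub>R u y) = 0" .
  qed
  then show "AE y in lborel. V_adj (qstft I f) y = 2 * f y"
    by eventually_elim (simp add: u_def g_def qstft_eq_stft[OF I f] scaleR_conv_of_real)
qed

end
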